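(* Let $A$ be an alphabet, let $F\subseteq A^*$ be a recurrent language over $A$, and let $X$ be a finite $F$-complete $F$-charged code contained in $F$ (so $X=Z\cap F$ for some $F$-charged rational complete bifix code $Z\subseteq A^+$). Then $F\cap X^*$, viewed as a language over the alphabet $X$, is recurrent over $X$. (That is: every charged complete bifix decoding of a recurrent language is recurrent.)
   Context: Alphabets are nonempty finite sets; $A^*$ is the free monoid on $A$ and $A^+$ the set of nonempty words. A language $F\subseteq A^*$ is factorial if closed under taking factors, prolongable if for every $u\in F$ there are $a,b\in A$ with $au,ub\in F$, and a subshift language if it is nonempty, factorial and prolongable. A subshift language $F$ is recurrent (over $A$) if for all $u,v\in F$ there is $w\in F$ with $uwv\in F$. $\widehat{A^*}$ is the free profinite monoid generated by $A$ ($A^*$ embeds densely in it); $\overline{L}$ is the closure in $\widehat{A^*}$ of a set $L$. In a monoid $M$, $x\leq_{\mathcal J}y$ iff $x\in MyM$; $x\leq_{\mathcal R}y$ iff $x\in yM$; $x\leq_{\mathcal L}y$ iff $x\in My$; $\mathcal J,\mathcal R,\mathcal L$ are the induced equivalences and $\mathcal H=\mathcal R\cap\mathcal L$. The maximal subgroups of $M$ are the $\mathcal H$-classes containing an idempotent. $J_A(F)$ is the set of $\leq_{\mathcal J}$-minimal elements (in the monoid $\widehat{A^*}$) of $\overline F$; if $F$ is recurrent it is a single regular $\mathcal J$-class. A code over $A$ is a nonempty subset of $A^+$ freely generating a submonoid of $A^*$; it is bifix if no element is a proper prefix or a proper suffix of another element. A code $Z\subseteq A^+$ is complete if every word of $A^*$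 is a prefix of an element of $Z^*$ and a suffix of an element of $Z^*$. A code $X\subseteq F$ is $F$-complete if every word of $F$ is a prefix of an element of $X^*$ and a suffix of an element of $X^*$. For a rational language $L\subseteq A^*$, $\hat\eta_L\colon\widehat{A^*}\to M(L)$ is the continuous extension of the syntactic homomorphism of $L$ onto its (finite) syntactic monoid $M(L)$. For $F$ recurrent, a rational complete bifix code $Z\subseteq A^+$ is $F$-charged if for every maximal subgroup $K\subseteq J_A(F)$ the image $\hat\eta_{Z^*}(K)$ is a maximal subgroup of $M(Z^* )$ contained in the minimum ideal of $M(Z^* )$. A rational code $X$ is $F$-complete $F$-charged if it is $F$-complete and $X=Z\cap F$ for some $F$-charged rational complete bifix code $Z\subseteq A^+$. Since $X$ is a code, $X^*$ is the free monoid on the alphabet $X$, and $F\cap X^*$ is regarded as a language over the alphabet $X$ (factors, etc. being taken in the free monoid on $X$). *)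

theory Defs
  imports "HOL-Analysis.Analysis" "HOL-Algebra.Product_Groups" "HOL-Library.Sublist"
begin

section \<open>Languages\<close>

text \<open>The free monoid on \<open>A\<close> is \<open>lists A\<close> under concatenation.\<close>

definition alphabet :: "'a set \<Rightarrow> bool" where
  "alphabet A \<longleftrightarrow> finite A \<and> A \<noteq> {}"

definition factorial :: "'a list set \<Rightarrow> bool" where
  "factorial F \<longleftrightarrow> (\<forall>u\<in>F. \<forall>v. sublist v u \<longrightarrow> v \<in> F)"

definition prolongable :: "'a set \<Rightarrow> 'a list set \<Rightarrow> bool" where
  "prolongable A F \<longleftrightarrow> (\<forall>u\<in>F. \<exists>a\<in>A. \<exists>b\<in>A. a # u \<in> F \<and> u @ [b] \<in> F)"

definition subshift_language :: "'a set \<Rightarrow> 'a list set \<Rightarrow> bool" where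
  "subshift_language A F \<longleftrightarrow> F \<subseteq> lists A \<and> F \<noteq> {} \<and> factorial F \<and> prolongable A F"

definition recurrent :: "'a set \<Rightarrow> 'a list set \<Rightarrow> bool" where
  "recurrent A F \<longleftrightarrow> subshift_language A F \<and> (\<forall>u\<in>F. \<forall>v\<in>F. \<exists>w\<in>F. u @ w @ v \<in> F)"

definition star :: "'a list set \<Rightarrow> 'a list set" where
  "star X = concat ` lists X"

inductive rational :: "'a set \<Rightarrow> 'a list set \<Rightarrow> bool" for A :: "'a set" where
  empty: "rational A {}"
| eps: "rational A {[]}"
| letter: "a \<in> A \<Longrightarrow> rational A {[a]}"
| union: "rational A K \<Longrightarrow> rational A L \<Longrightarrow> rational A (K \<union> L)"
| conc: "rational A K \<Longrightarrow> rational A L \<Longrightarrow> rational A {u @ v | u v. u \<in> K \<and> v \<in> L}"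
| star: "rational A L \<Longrightarrow> rational A (star L)"


section \<open>The free profinite monoid\<close>

definition congs :: "'a set \<Rightarrow> ('a list \<times> 'a list) set set" where
  "congs A = {\<theta>. equiv (lists A) \<theta> \<and>
     (\<forall>u u' v v'. (u, u') \<in> \<theta> \<longrightarrow> (v, v') \<in> \<theta> \<longrightarrow> (u @ v, u' @ v') \<in> \<theta>)}"

definition fin_congs :: "'a set \<Rightarrow> ('a list \<times> 'a list) set set" where
  "fin_congs A = {\<theta> \<in> congs A. finite (lists A // \<theta>)}"

text \<open>For a congruence \<open>\<theta>\<close>, the product of two classes is the class that contains their
  elementwise concatenations.\<close>

definition quot_monoid :: "'a set \<Rightarrow> ('a list \<times> 'a list) set \<Rightarrow> 'a list set monoid" where
  "quot_monoid A \<theta> = \<lparr>carrier = lists A // \<theta>,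
     monoid.mult = (\<lambda>C D. \<theta> `` {u @ v | u v. u \<in> C \<and> v \<in> D}),
     one = \<theta> `` {[]}\<rparr>"

type_synonym 'a profinite_word = "('a list \<times> 'a list) set \<Rightarrow> 'a list set"

text \<open>The free profinite monoid on \<open>A\<close> is the projective limit of the finite quotients of the free
  monoid. Despite its name, \<^const>\<open>product_group\<close> is the direct product of arbitrary monoids.\<close>

definition profinite_monoid :: "'a set \<Rightarrow> 'a profinite_word monoid" where
  "profinite_monoid A = (product_group (fin_congs A) (quot_monoid A))
     \<lparr>carrier := {x \<in> \<Pi>\<^sub>E \<theta>\<in>fin_congs A. lists A // \<theta>.
        \<forall>\<theta>\<in>fin_congs A. \<forall>\<phi>\<in>fin_congs A. \<theta> \<subseteq> \<phi> \<longrightarrow> x \<theta> \<subseteq> x \<phi>}\<rparr>"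

definition profinite_topology :: "'a set \<Rightarrow> 'a profinite_word topology" where
  "profinite_topology A = subtopology
     (product_topology (\<lambda>\<theta>. discrete_topology (lists A // \<theta>)) (fin_congs A))
     (carrier (profinite_monoid A))"

definition emb :: "'a set \<Rightarrow> 'a list \<Rightarrow> 'a profinite_word" where
  "emb A w = (\<lambda>\<theta>\<in>fin_congs A. \<theta> `` {w})"

definition profinite_closure :: "'a set \<Rightarrow> 'a list set \<Rightarrow> 'a profinite_word set" where
  "profinite_closure A L = profinite_topology A closure_of (emb A ` L)"


section \<open>Green's relations, maximal subgroups and the minimum ideal\<close>

definition J_le :: "('m, 'z) monoid_scheme \<Rightarrow> 'm \<Rightarrow> 'm \<Rightarrow> bool" where
  "J_le M x y \<longleftrightarrow> (\<exists>u\<in>carrier M. \<exists>v\<in>carrier M. x = u \<otimes>\<^bsub>M\<^esub> y \<otimes>\<^bsub>M\<^esub> v)"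

definition R_le :: "('m, 'z) monoid_scheme \<Rightarrow> 'm \<Rightarrow> 'm \<Rightarrow> bool" where
  "R_le M x y \<longleftrightarrow> (\<exists>u\<in>carrier M. x = y \<otimes>\<^bsub>M\<^esub> u)"

definition L_le :: "('m, 'z) monoid_scheme \<Rightarrow> 'm \<Rightarrow> 'm \<Rightarrow> bool" where
  "L_le M x y \<longleftrightarrow> (\<exists>u\<in>carrier M. x = u \<otimes>\<^bsub>M\<^esub> y)"

definition R_eq :: "('m, 'z) monoid_scheme \<Rightarrow> 'm \<Rightarrow> 'm \<Rightarrow> bool" where
  "R_eq M x y \<longleftrightarrow> R_le M x y \<and> R_le M y x"

definition L_eq :: "('m, 'z) monoid_scheme \<Rightarrow> 'm \<Rightarrow> 'm \<Rightarrow> bool" where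
  "L_eq M x y \<longleftrightarrow> L_le M x y \<and> L_le M y x"

definition H_class :: "('m, 'z) monoid_scheme \<Rightarrow> 'm \<Rightarrow> 'm set" where
  "H_class M x = {y \<in> carrier M. R_eq M x y \<and> L_eq M x y}"

definition maximal_subgroups :: "('m, 'z) monoid_scheme \<Rightarrow> 'm set set" where
  "maximal_subgroups M =
     {H_class M x | x. x \<in> carrier M \<and> (\<exists>e\<in>H_class M x. e \<otimes>\<^bsub>M\<^esub> e = e)}"

definition monoid_ideal :: "('m, 'z) monoid_scheme \<Rightarrow> 'm set \<Rightarrow> bool" where
  "monoid_ideal M I \<longleftrightarrow> I \<subseteq> carrier M \<and> I \<noteq> {} \<and>
     (\<forall>x\<in>I. \<forall>m\<in>carrier M. m \<otimes>\<^bsub>M\<^esub> x \<in> I \<and> x \<otimes>\<^bsub>M\<^esub> m \<in> I)"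

definition minimum_ideal :: "('m, 'z) monoid_scheme \<Rightarrow> 'm set" where
  "minimum_ideal M = \<Inter>{I. monoid_ideal M I}"

definition J_class :: "'a set \<Rightarrow> 'a list set \<Rightarrow> 'a profinite_word set" where
  "J_class A F = {x \<in> profinite_closure A F. \<forall>y\<in>profinite_closure A F.
     J_le (profinite_monoid A) y x \<longrightarrow> J_le (profinite_monoid A) x y}"


section \<open>Syntactic monoids\<close>

definition synt_cong :: "'a set \<Rightarrow> 'a list set \<Rightarrow> ('a list \<times> 'a list) set" where
  "synt_cong A L = {(u, v). u \<in> lists A \<and> v \<in> lists A \<and>
     (\<forall>p\<in>lists A. \<forall>q\<in>lists A. p @ u @ q \<in> L \<longleftrightarrow> p @ v @ q \<in> L)}"

definition synt_monoid :: "'a set \<Rightarrow> 'a list set \<Rightarrow> 'a list set monoid" where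
  "synt_monoid A L = quot_monoid A (synt_cong A L)"

definition synt_hom :: "'a set \<Rightarrow> 'a list set \<Rightarrow> 'a list \<Rightarrow> 'a list set" where
  "synt_hom A L w = synt_cong A L `` {w}"

text \<open>The continuous extension of the syntactic homomorphism. It exists and is unique whenever the
  syntactic monoid is finite, in particular for rational languages; see \<open>synt_hat_eq\<close> below.\<close>

definition is_synt_hat :: "'a set \<Rightarrow> 'a list set \<Rightarrow> ('a profinite_word \<Rightarrow> 'a list set) \<Rightarrow> bool" where
  "is_synt_hat A L f \<longleftrightarrow> f \<in> extensional (carrier (profinite_monoid A)) \<and>
     continuous_map (profinite_topology A) (discrete_topology (carrier (synt_monoid A L))) f \<and>
     (\<forall>w\<in>lists A. f (emb A w) = synt_hom A L w)"

definition synt_hat :: "'a set \<Rightarrow> 'a list set \<Rightarrow> 'a profinite_word \<Rightarrow> 'a list set" where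
  "synt_hat A L = (THE f. is_synt_hat A L f)"


section \<open>Codes\<close>

definition code_over :: "'a set \<Rightarrow> 'a list set \<Rightarrow> bool" where
  "code_over A X \<longleftrightarrow> X \<noteq> {} \<and> X \<subseteq> lists A - {[]} \<and> inj_on concat (lists X)"

definition bifix :: "'a list set \<Rightarrow> bool" where
  "bifix X \<longleftrightarrow> (\<forall>x\<in>X. \<forall>y\<in>X. \<not> strict_prefix x y \<and> \<not> strict_suffix x y)"

definition complete_in :: "'a list set \<Rightarrow> 'a list set \<Rightarrow> bool" where
  "complete_in F X \<longleftrightarrow> (\<forall>w\<in>F. (\<exists>y\<in>star X. prefix w y) \<and> (\<exists>y\<in>star X. suffix w y))"

definition F_complete :: "'a set \<Rightarrow> 'a list set \<Rightarrow> 'a list set \<Rightarrow> bool" where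
  "F_complete A F X \<longleftrightarrow> code_over A X \<and> X \<subseteq> F \<and> complete_in F X"

definition F_charged :: "'a set \<Rightarrow> 'a list set \<Rightarrow> 'a list set \<Rightarrow> bool" where
  "F_charged A F Z \<longleftrightarrow>
     code_over A Z \<and> bifix Z \<and> complete_in (lists A) Z \<and> rational A Z \<and>
     (\<forall>K\<in>maximal_subgroups (profinite_monoid A). K \<subseteq> J_class A F \<longrightarrow>
        synt_hat A (star Z) ` K \<in> maximal_subgroups (synt_monoid A (star Z)) \<and>
        synt_hat A (star Z) ` K \<subseteq> minimum_ideal (synt_monoid A (star Z)))"

definition F_complete_F_charged :: "'a set \<Rightarrow> 'a list set \<Rightarrow> 'a list set \<Rightarrow> bool" where
  "F_complete_F_charged A F X \<longleftrightarrow>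
     rational A X \<and> F_complete A F X \<and> (\<exists>Z. F_charged A F Z \<and> X = Z \<inter> F)"

text \<open>The intersection of \<open>F\<close> with \<open>star X\<close>, read as a language over the alphabet \<open>X\<close>: a word
  over \<open>X\<close> is a list of elements of \<open>X\<close>, identified with its concatenation.\<close>

definition decoding :: "'a list set \<Rightarrow> 'a list set \<Rightarrow> 'a list list set" where
  "decoding X F = {us \<in> lists X. concat us \<in> F}"


section \<open>Basic properties\<close>

lemma carrier_profinite_monoid:
  "carrier (profinite_monoid A) = {x \<in> \<Pi>\<^sub>E \<theta>\<in>fin_congs A. lists A // \<theta>.
     \<forall>\<theta>\<in>fin_congs A. \<forall>\<phi>\<in>fin_congs A. \<theta> \<subseteq> \<phi> \<longrightarrow> x \<theta> \<subseteq> x \<phi>}"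
  by (simp add: profinite_monoid_def)

lemma congs_equiv: "\<theta> \<in> congs A \<Longrightarrow> equiv (lists A) \<theta>"
  by (simp add: congs_def)

lemma mult_quot_monoid:
  assumes "\<theta> \<in> congs A" "u \<in> lists A" "v \<in> lists A"
  shows "\<theta> `` {u} \<otimes>\<^bsub>quot_monoid A \<theta>\<^esub> \<theta> `` {v} = \<theta> `` {u @ v}"
proof -
  have eq: "equiv (lists A) \<theta>"
    and c: "\<And>u u' v v'. (u, u') \<in> \<theta> \<Longrightarrow> (v, v') \<in> \<theta> \<Longrightarrow> (u @ v, u' @ v') \<in> \<theta>"
    using assms(1) by (auto simp: congs_def)
  have r: "(u, u) \<in> \<theta>" "(v, v) \<in> \<theta>"
    using eq assms by (auto simp: equiv_def refl_on_def)
  have t: "\<And>x y z. (x, y) \<in> \<theta> \<Longrightarrow> (y, z) \<in> \<theta> \<Longrightarrow> (x, z) \<in> \<theta>"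
    using eq by (meson equiv_def transE)
  show ?thesis
    using r by (auto simp: quot_monoid_def dest: t[OF c])
qed

lemma quot_monoid_is_monoid:
  assumes "\<theta> \<in> congs A"
  shows "monoid (quot_monoid A \<theta>)"
proof (rule monoidI)
  let ?M = "quot_monoid A \<theta>"
  have one: "\<one>\<^bsub>?M\<^esub> = \<theta> `` {[]}" by (simp add: quot_monoid_def)
  have car: "carrier ?M = lists A // \<theta>" by (simp add: quot_monoid_def)
  note m = mult_quot_monoid[OF assms]
  show "\<one>\<^bsub>?M\<^esub> \<in> carrier ?M" by (auto simp: one car quotient_def)
  show "x \<otimes>\<^bsub>?M\<^esub> y \<in> carrier ?M" if "x \<in> carrier ?M" "y \<in> carrier ?M" for x y
  proof -
    obtain u where "u \<in> lists A" "x = \<theta> `` {u}"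
      using \<open>x \<in> carrier ?M\<close> unfolding car by (rule quotientE)
    moreover obtain v where "v \<in> lists A" "y = \<theta> `` {v}"
      using \<open>y \<in> carrier ?M\<close> unfolding car by (rule quotientE)
    ultimately show ?thesis by (simp add: car m quotientI)
  qed
  show "x \<otimes>\<^bsub>?M\<^esub> y \<otimes>\<^bsub>?M\<^esub> z = x \<otimes>\<^bsub>?M\<^esub> (y \<otimes>\<^bsub>?M\<^esub> z)"
    if "x \<in> carrier ?M" "y \<in> carrier ?M" "z \<in> carrier ?M" for x y z
  proof -
    obtain u where "u \<in> lists A" "x = \<theta> `` {u}"
      using \<open>x \<in> carrier ?M\<close> unfolding car by (rule quotientE)
    moreover obtain v where "v \<in> lists A" "y = \<theta> `` {v}"
      using \<open>y \<in> carrier ?M\<close> unfolding car by (rule quotientE)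
    moreover obtain w where "w \<in> lists A" "z = \<theta> `` {w}"
      using \<open>z \<in> carrier ?M\<close> unfolding car by (rule quotientE)
    ultimately show ?thesis by (simp add: m)
  qed
  show "\<one>\<^bsub>?M\<^esub> \<otimes>\<^bsub>?M\<^esub> x = x" if "x \<in> carrier ?M" for x
  proof -
    obtain u where "u \<in> lists A" "x = \<theta> `` {u}"
      using \<open>x \<in> carrier ?M\<close> unfolding car by (rule quotientE)
    then show ?thesis by (simp add: one m)
  qed
  show "x \<otimes>\<^bsub>?M\<^esub> \<one>\<^bsub>?M\<^esub> = x" if "x \<in> carrier ?M" for x
  proof -
    obtain u where "u \<in> lists A" "x = \<theta> `` {u}"
      using \<open>x \<in> carrier ?M\<close> unfolding car by (rule quotientE)
    then show ?thesis by (simp add: one m)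
  qed
qed

lemma quotient_subset_mult:
  assumes "\<theta> \<in> congs A" "\<phi> \<in> congs A" "\<theta> \<subseteq> \<phi>" "C \<subseteq> C'" "D \<subseteq> D'"
  shows "C \<otimes>\<^bsub>quot_monoid A \<theta>\<^esub> D \<subseteq> C' \<otimes>\<^bsub>quot_monoid A \<phi>\<^esub> D'"
  using assms(3-) by (auto simp: quot_monoid_def Image_iff) blast

lemma fin_congsD: "\<theta> \<in> fin_congs A \<Longrightarrow> \<theta> \<in> congs A" "\<theta> \<in> fin_congs A \<Longrightarrow> finite (lists A // \<theta>)"
  by (auto simp: fin_congs_def)

lemma profinite_monoid_is_monoid: "monoid (profinite_monoid A)"
proof (rule monoidI)
  let ?M = "profinite_monoid A"
  have q: "monoid (quot_monoid A \<theta>)" if "\<theta> \<in> fin_congs A" for \<theta>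
    using that fin_congsD(1) quot_monoid_is_monoid by blast
  have car: "carrier (quot_monoid A \<theta>) = lists A // \<theta>" for \<theta> by (simp add: quot_monoid_def)
  have mult: "x \<otimes>\<^bsub>?M\<^esub> y = (\<lambda>\<theta>\<in>fin_congs A. x \<theta> \<otimes>\<^bsub>quot_monoid A \<theta>\<^esub> y \<theta>)" for x y
    by (simp add: profinite_monoid_def product_group_def)
  have one: "\<one>\<^bsub>?M\<^esub> = (\<lambda>\<theta>\<in>fin_congs A. \<one>\<^bsub>quot_monoid A \<theta>\<^esub>)"
    by (simp add: profinite_monoid_def product_group_def)
  have el: "x \<theta> \<in> carrier (quot_monoid A \<theta>)"
    if "x \<in> carrier ?M" "\<theta> \<in> fin_congs A" for x \<theta>
    using that by (auto simp: carrier_profinite_monoid car)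
  show "\<one>\<^bsub>?M\<^esub> \<in> carrier ?M"
    using monoid.one_closed[OF q]
    by (auto simp: one carrier_profinite_monoid car) (auto simp: quot_monoid_def)
  show "x \<otimes>\<^bsub>?M\<^esub> y \<in> carrier ?M" if "x \<in> carrier ?M" "y \<in> carrier ?M" for x y
  proof -
    have "x \<theta> \<otimes>\<^bsub>quot_monoid A \<theta>\<^esub> y \<theta> \<in> lists A // \<theta>" if "\<theta> \<in> fin_congs A" for \<theta>
      using monoid.m_closed[OF q el el] that \<open>x \<in> _\<close> \<open>y \<in> _\<close> car by blast
    moreover have "x \<theta> \<otimes>\<^bsub>quot_monoid A \<theta>\<^esub> y \<theta> \<subseteq> x \<phi> \<otimes>\<^bsub>quot_monoid A \<phi>\<^esub> y \<phi>"
      if "\<theta> \<in> fin_congs A" "\<phi> \<in> fin_congs A" "\<theta> \<subseteq> \<phi>" for \<theta> \<phi>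
      using that \<open>x \<in> _\<close> \<open>y \<in> _\<close>
      by (intro quotient_subset_mult fin_congsD) (auto simp: carrier_profinite_monoid)
    ultimately show ?thesis by (auto simp: mult carrier_profinite_monoid)
  qed
  show "x \<otimes>\<^bsub>?M\<^esub> y \<otimes>\<^bsub>?M\<^esub> z = x \<otimes>\<^bsub>?M\<^esub> (y \<otimes>\<^bsub>?M\<^esub> z)"
    if "x \<in> carrier ?M" "y \<in> carrier ?M" "z \<in> carrier ?M" for x y z
  proof -
    have "x \<theta> \<otimes>\<^bsub>quot_monoid A \<theta>\<^esub> y \<theta> \<otimes>\<^bsub>quot_monoid A \<theta>\<^esub> z \<theta> =
        x \<theta> \<otimes>\<^bsub>quot_monoid A \<theta>\<^esub> (y \<theta> \<otimes>\<^bsub>quot_monoid A \<theta>\<^esub> z \<theta>)" if "\<theta> \<in> fin_congs A" for \<theta>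
      using monoid.m_assoc[OF q el el el] that \<open>x \<in> _\<close> \<open>y \<in> _\<close> \<open>z \<in> _\<close> by blast
    then show ?thesis by (simp add: mult cong: restrict_cong)
  qed
  show "\<one>\<^bsub>?M\<^esub> \<otimes>\<^bsub>?M\<^esub> x = x" if "x \<in> carrier ?M" for x
  proof
    fix \<theta>
    show "(\<one>\<^bsub>?M\<^esub> \<otimes>\<^bsub>?M\<^esub> x) \<theta> = x \<theta>"
      using that monoid.l_one[OF q el[OF that]]
      by (cases "\<theta> \<in> fin_congs A") (auto simp: mult one carrier_profinite_monoid PiE_def extensional_def)
  qed
  show "x \<otimes>\<^bsub>?M\<^esub> \<one>\<^bsub>?M\<^esub> = x" if "x \<in> carrier ?M" for x
  proof
    fix \<theta>
    show "(x \<otimes>\<^bsub>?M\<^esub> \<one>\<^bsub>?M\<^esub>) \<theta> = x \<theta>"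
      using that monoid.r_one[OF q el[OF that]]
      by (cases "\<theta> \<in> fin_congs A") (auto simp: mult one carrier_profinite_monoid PiE_def extensional_def)
  qed
qed

lemma topspace_profinite_topology: "topspace (profinite_topology A) = carrier (profinite_monoid A)"
  by (auto simp: profinite_topology_def carrier_profinite_monoid)

lemma emb_in_carrier: "w \<in> lists A \<Longrightarrow> emb A w \<in> carrier (profinite_monoid A)"
  by (auto simp: carrier_profinite_monoid emb_def intro: quotientI)

lemma emb_append:
  assumes "u \<in> lists A" "v \<in> lists A"
  shows "emb A (u @ v) = emb A u \<otimes>\<^bsub>profinite_monoid A\<^esub> emb A v"
  using mult_quot_monoid[OF fin_congsD(1) assms]
  by (auto simp: emb_def profinite_monoid_def product_group_def intro!: restrict_ext)

lemma emb_Nil: "emb A [] = \<one>\<^bsub>profinite_monoid A\<^esub>"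
  by (auto simp: emb_def profinite_monoid_def product_group_def quot_monoid_def)

lemma fin_congs_Int:
  assumes "\<theta> \<in> fin_congs A" "\<phi> \<in> fin_congs A"
  shows "\<theta> \<inter> \<phi> \<in> fin_congs A"
proof -
  have "\<theta> \<inter> \<phi> \<in> congs A"
  proof -
    have "equiv (lists A) \<theta>" "equiv (lists A) \<phi>"
      using assms fin_congsD(1) congs_equiv by blast+
    then have "equiv (lists A) (\<theta> \<inter> \<phi>)"
      by (auto simp: equiv_def refl_on_def intro: sym_Int trans_Int)
    then show ?thesis using assms by (simp add: fin_congs_def congs_def)
  qed
  moreover have "lists A // (\<theta> \<inter> \<phi>) \<subseteq> (\<lambda>(C, D). C \<inter> D) ` ((lists A // \<theta>) \<times> (lists A // \<phi>))"
    by (force simp: quotient_def image_iff)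
  then have "finite (lists A // (\<theta> \<inter> \<phi>))"
    by (rule finite_subset) (use assms in \<open>auto simp: fin_congs_def\<close>)
  ultimately show ?thesis by (simp add: fin_congs_def)
qed

lemma fin_congs_total: "lists A \<times> lists A \<in> fin_congs A"
proof -
  have "lists A // (lists A \<times> lists A) \<subseteq> {lists A}" by (auto simp: quotient_def)
  then have "finite (lists A // (lists A \<times> lists A))" by (rule finite_subset) simp
  then show ?thesis
    by (auto simp: fin_congs_def congs_def equiv_def refl_on_def sym_def trans_def)
qed

lemma fin_congs_Inter:
  assumes "finite T" "T \<subseteq> fin_congs A"
  shows "\<exists>\<theta>\<in>fin_congs A. \<forall>\<phi>\<in>T. \<theta> \<subseteq> \<phi>"
  using assms
proof (induction T)
  case empty
  then show ?case using fin_congs_total by blast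
next
  case (insert \<phi> T)
  then obtain \<theta> where "\<theta> \<in> fin_congs A" "\<forall>\<phi>\<in>T. \<theta> \<subseteq> \<phi>" by blast
  then have "\<theta> \<inter> \<phi> \<in> fin_congs A" "\<forall>\<psi>\<in>insert \<phi> T. \<theta> \<inter> \<phi> \<subseteq> \<psi>"
    using insert.prems fin_congs_Int by auto
  then show ?case by blast
qed

lemma profinite_eq_if_subset:
  assumes "x \<in> carrier (profinite_monoid A)" "\<theta> \<in> fin_congs A" "\<phi> \<in> fin_congs A" "\<theta> \<subseteq> \<phi>"
    and "x \<theta> = \<theta> `` {w}" "w \<in> lists A"
  shows "x \<phi> = \<phi> `` {w}"
proof -
  have eq: "equiv (lists A) \<theta>" "equiv (lists A) \<phi>" using assms fin_congsD congs_equiv by blast+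
  have "w \<in> x \<theta>" using assms(5,6) eq(1) by (metis equiv_class_self)
  moreover have "x \<theta> \<subseteq> x \<phi>" using assms(1-4) by (simp add: carrier_profinite_monoid)
  ultimately have "w \<in> x \<phi>" by blast
  moreover have "x \<phi> \<in> lists A // \<phi>" using assms by (auto simp: carrier_profinite_monoid)
  ultimately show ?thesis
    using eq(2) by (metis Image_singleton_iff equiv_class_eq quotientE)
qed

lemma in_profinite_closure_iff:
  assumes "L \<subseteq> lists A"
  shows "x \<in> profinite_closure A L \<longleftrightarrow>
    x \<in> carrier (profinite_monoid A) \<and> (\<forall>\<theta>\<in>fin_congs A. \<exists>w\<in>L. x \<theta> = \<theta> `` {w})"
    (is "?lhs \<longleftrightarrow> ?rhs")
proof
  let ?P = "product_topology (\<lambda>\<theta>. discrete_topology (lists A // \<theta>)) (fin_congs A)"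
  assume ?lhs
  then have x: "x \<in> carrier (profinite_monoid A)"
    and cl: "\<And>T. x \<in> T \<Longrightarrow> openin (profinite_topology A) T \<Longrightarrow> \<exists>w\<in>L. emb A w \<in> T"
    by (auto simp: profinite_closure_def in_closure_of topspace_profinite_topology)
  have "\<exists>w\<in>L. x \<theta> = \<theta> `` {w}" if t: "\<theta> \<in> fin_congs A" for \<theta>
  proof -
    have "openin ?P {y \<in> topspace ?P. y \<theta> \<in> {x \<theta>}}"
      using x t by (intro openin_continuous_map_preimage[OF continuous_map_product_projection])
        (auto simp: carrier_profinite_monoid)
    then have "openin (profinite_topology A)
        ({y \<in> topspace ?P. y \<theta> \<in> {x \<theta>}} \<inter> carrier (profinite_monoid A))"
      unfolding profinite_topology_def openin_subtopology by blast
    moreover have "x \<in> {y \<in> topspace ?P. y \<theta> \<in> {x \<theta>}} \<inter> carrier (profinite_monoid A)"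
      using x by (auto simp: carrier_profinite_monoid)
    ultimately obtain w where "w \<in> L" and
      "emb A w \<in> {y \<in> topspace ?P. y \<theta> \<in> {x \<theta>}} \<inter> carrier (profinite_monoid A)"
      using cl by meson
    then have "w \<in> L \<and> x \<theta> = \<theta> `` {w}" using t by (auto simp: emb_def)
    then show ?thesis by blast
  qed
  with x show ?rhs by blast
next
  let ?D = "\<lambda>\<theta>. discrete_topology (lists A // \<theta>)"
  assume R: ?rhs
  have "\<exists>w\<in>L. emb A w \<in> T" if xT: "x \<in> T" and op: "openin (profinite_topology A) T" for T
  proof -
    obtain S where S: "openin (product_topology ?D (fin_congs A)) S"
      and T: "T = S \<inter> carrier (profinite_monoid A)"
      using op unfolding profinite_topology_def openin_subtopology by blast
    obtain U where U: "finite {\<theta> \<in> fin_congs A. U \<theta> \<noteq> topspace (?D \<theta>)}"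
      "x \<in> Pi\<^sub>E (fin_congs A) U" "Pi\<^sub>E (fin_congs A) U \<subseteq> S"
    proof -
      have "x \<in> S" using xT T by blast
      then have "\<exists>U. finite {\<theta> \<in> fin_congs A. U \<theta> \<noteq> topspace (?D \<theta>)} \<and>
          (\<forall>\<theta>\<in>fin_congs A. openin (?D \<theta>) (U \<theta>)) \<and>
          x \<in> Pi\<^sub>E (fin_congs A) U \<and> Pi\<^sub>E (fin_congs A) U \<subseteq> S"
        using S unfolding openin_product_topology_alt by (rule bspec[rotated])
      then show thesis by (elim exE conjE) (rule that)
    qed
    obtain \<theta> where th: "\<theta> \<in> fin_congs A"
      "\<forall>\<phi>\<in>{\<theta> \<in> fin_congs A. U \<theta> \<noteq> topspace (?D \<theta>)}. \<theta> \<subseteq> \<phi>"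
      using fin_congs_Inter[OF U(1)] by blast
    obtain w where w: "w \<in> L" "x \<theta> = \<theta> `` {w}" using R th(1) by blast
    have wA: "w \<in> lists A" using w assms by blast
    have "\<phi> `` {w} \<in> U \<phi>" if ph: "\<phi> \<in> fin_congs A" for \<phi>
    proof (cases "U \<phi> = topspace (?D \<phi>)")
      case True
      then show ?thesis using wA by (simp add: quotientI)
    next
      case False
      then have "x \<phi> = \<phi> `` {w}"
        using th ph w wA R profinite_eq_if_subset[of x A \<theta> \<phi> w] by blast
      then show ?thesis using PiE_mem[OF U(2) ph] by simp
    qed
    then have "emb A w \<in> Pi\<^sub>E (fin_congs A) U" by (auto simp: emb_def)
    then show ?thesis using U(3) T w(1) emb_in_carrier[OF wA] by blast
  qed
  with R show ?lhs
    by (auto simp: profinite_closure_def in_closure_of topspace_profinite_topology)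
qed

lemma emb_dense: "profinite_closure A (lists A) = carrier (profinite_monoid A)"
proof -
  have "\<exists>w\<in>lists A. x \<theta> = \<theta> `` {w}"
    if "x \<in> carrier (profinite_monoid A)" "\<theta> \<in> fin_congs A" for x \<theta>
  proof -
    have "x \<theta> \<in> lists A // \<theta>" using that by (auto simp: carrier_profinite_monoid)
    then show ?thesis by (auto elim!: quotientE)
  qed
  then show ?thesis by (auto simp: in_profinite_closure_iff)
qed

lemma synt_congD:
  assumes "(u, v) \<in> synt_cong A L" "p \<in> lists A" "q \<in> lists A"
  shows "p @ u @ q \<in> L \<longleftrightarrow> p @ v @ q \<in> L"
  using assms unfolding synt_cong_def by blast

lemma synt_cong_congs: "synt_cong A L \<in> congs A"
proof -
  have "equiv (lists A) (synt_cong A L)"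
    by (auto simp: synt_cong_def equiv_def refl_on_def sym_def trans_def)
  moreover have "(u @ v, u' @ v') \<in> synt_cong A L"
    if "(u, u') \<in> synt_cong A L" "(v, v') \<in> synt_cong A L" for u u' v v'
  proof -
    have A: "u \<in> lists A" "u' \<in> lists A" "v \<in> lists A" "v' \<in> lists A"
      using that by (auto simp: synt_cong_def)
    have "p @ (u @ v) @ q \<in> L \<longleftrightarrow> p @ (u' @ v') @ q \<in> L"
      if pq: "p \<in> lists A" "q \<in> lists A" for p q
    proof -
      have "p @ u @ (v @ q) \<in> L \<longleftrightarrow> p @ u' @ (v @ q) \<in> L"
        using \<open>(u, u') \<in> _\<close> pq A by (intro synt_congD) auto
      moreover have "(p @ u') @ v @ q \<in> L \<longleftrightarrow> (p @ u') @ v' @ q \<in> L"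
        using \<open>(v, v') \<in> _\<close> pq A by (intro synt_congD) auto
      ultimately show ?thesis by simp
    qed
    with A show ?thesis by (simp add: synt_cong_def)
  qed
  ultimately show ?thesis by (auto simp: congs_def)
qed

lemma synt_hat_eq:
  assumes "finite (carrier (synt_monoid A L))"
  shows "is_synt_hat A L (synt_hat A L)"
    and "x \<in> carrier (profinite_monoid A) \<Longrightarrow> synt_hat A L x = x (synt_cong A L)"
proof -
  let ?S = "synt_cong A L" and ?C = "carrier (profinite_monoid A)"
  let ?f = "\<lambda>x\<in>?C. x ?S"
  let ?Y = "discrete_topology (lists A // ?S)"
  have car: "carrier (synt_monoid A L) = lists A // ?S"
    by (simp add: synt_monoid_def quot_monoid_def)
  have S: "?S \<in> fin_congs A"
    using assms synt_cong_congs by (auto simp: fin_congs_def car)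
  have "continuous_map (profinite_topology A) ?Y (\<lambda>x. x ?S)"
    unfolding profinite_topology_def
    using continuous_map_product_projection[OF S, of "\<lambda>\<theta>. discrete_topology (lists A // \<theta>)"]
    by (intro continuous_map_from_subtopology) simp
  then have "continuous_map (profinite_topology A) ?Y ?f"
    by (rule continuous_map_eq) (auto simp: topspace_profinite_topology)
  then have f: "is_synt_hat A L ?f"
    using S emb_in_carrier[of _ A] by (auto simp: is_synt_hat_def car synt_hom_def emb_def)
  have uniq: "g = ?f" if g: "is_synt_hat A L g" for g
  proof
    fix x
    show "g x = ?f x"
    proof (cases "x \<in> ?C")
      case True
      then have "x \<in> profinite_topology A closure_of (emb A ` lists A)"
        using emb_dense by (auto simp: profinite_closure_def)
      then show ?thesis
      proof (rule forall_in_closure_of_eq)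
        show "Hausdorff_space ?Y" by simp
        show "continuous_map (profinite_topology A) ?Y g"
          "continuous_map (profinite_topology A) ?Y ?f"
          using f g by (auto simp: is_synt_hat_def car)
        show "g y = ?f y" if y: "y \<in> emb A ` lists A" for y
        proof -
          obtain w where w: "w \<in> lists A" "y = emb A w" using y by blast
          have "g y = synt_hom A L w" using g w by (simp add: is_synt_hat_def)
          moreover have "\<forall>w\<in>lists A. ?f (emb A w) = synt_hom A L w"
            using f unfolding is_synt_hat_def by (elim conjE)
          then have "?f y = synt_hom A L w" unfolding w(2) using w(1) by (rule bspec)
          ultimately show ?thesis by simp
        qed
      qed
    next
      case False
      then show ?thesis using g by (auto simp: is_synt_hat_def extensional_def)
    qed
  qed
  have "synt_hat A L = ?f"
    unfolding synt_hat_def using f uniq by (rule the_equality)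
  with f show "is_synt_hat A L (synt_hat A L)"
    and "x \<in> ?C \<Longrightarrow> synt_hat A L x = x ?S" by auto
qed

end

theory Submission
  imports Defs
begin

text \<open>Let \<open>\<eta>\<close> be the syntactic homomorphism of \<open>Z\<^sup>*\<close>. Compactness and recurrence provide an idempotent \<open>d\<close>
  in the closure of \<open>F\<close> that lies J-below the whole closure; in particular all words of \<open>F\<close> are
  factors of \<open>d\<close>. Given \<open>u, v \<in> F \<inter> Z\<^sup>*\<close>, conjugating \<open>d\<close> yields idempotents \<open>e\<close> with prefix \<open>u\<close> and \<open>f\<close>
  with suffix \<open>v\<close>, and an element \<open>z = e b f\<close> of the L-class of \<open>f\<close>. For every \<open>k\<close> in the maximal subgroup
  \<open>K\<close> of \<open>f\<close>, the element \<open>z k\<close> has the form \<open>u y v\<close> and stays in the closure of \<open>F\<close>, which is closed under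
  taking factors. As \<open>Z\<close> is charged, \<open>\<eta>(K)\<close> is a full maximal subgroup in the minimum ideal, so
  \<open>\<eta>(z k)\<close> runs through an entire H-class of the minimum ideal; completeness of \<open>Z\<close> on both sides
  puts an element of \<open>\<eta>(Z\<^sup>*)\<close> into that H-class. Approximating the corresponding \<open>z k\<close> by words
  gives \<open>u w v \<in> F \<inter> Z\<^sup>*\<close>, and \<open>w \<in> Z\<^sup>*\<close> because \<open>Z\<close> is bifix. The factors of \<open>w\<close> in \<open>Z\<close> are factors of a
  word of \<open>F\<close>, hence lie in \<open>X\<close>.\<close>


section \<open>Ultrafilter limits in the free profinite monoid\<close>

text \<open>Zorn's lemma gives a minimal proper filter \<open>U\<close> below \<open>G\<close>. If
  \<open>U\<close> does not force the negation of \<open>P\<close>, then its infimum with the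
  principal filter of \<open>P\<close> is still proper, so minimality makes \<open>P\<close> hold
  eventually.\<close>

lemma ultrafilter_exists:
  fixes G :: "'i filter"
  assumes "G \<noteq> bot"
  obtains U where "U \<le> G" "U \<noteq> bot"
    "\<And>P. eventually P U \<or> eventually (\<lambda>x. \<not> P x) U"
proof -
  let ?S = "{U. U \<noteq> bot \<and> U \<le> G}"
  have "\<exists>U\<in>?S. \<forall>V\<in>?S. U \<ge> V \<longrightarrow> V = U"
  proof (rule predicate_Zorn)
    show "partial_order_on ?S (relation_of (\<ge>) ?S)"
      by (auto simp: partial_order_on_def preorder_on_def refl_on_def trans_def antisym_def
          relation_of_def)
    show "\<exists>u\<in>?S. \<forall>a\<in>C. u \<le> a"
      if C: "C \<in> Chains (relation_of (\<ge>) ?S)" for C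
    proof (cases "C = {}")
      case True
      with assms show ?thesis by auto
    next
      case False
      have CS: "C \<subseteq> ?S" and ch: "\<And>U V. U \<in> C \<Longrightarrow> V \<in> C \<Longrightarrow> U \<le> V \<or> V \<le> U"
        using C by (auto simp: Chains_def relation_of_def)
      \<comment> \<open>A chain is directed, so what holds eventually for \<open>Inf C\<close>
        already does so for some member; hence \<open>Inf C\<close> stays proper.\<close>
      have "eventually P (Inf C) \<longleftrightarrow> (\<exists>U\<in>C. eventually P U)" for P
        using False ch by (intro eventually_Inf_base) (metis inf.absorb1 inf.absorb2 order_refl)+
      then have "eventually (\<lambda>_. False) (Inf C) \<longleftrightarrow> (\<exists>U\<in>C. eventually (\<lambda>_. False) U)" .
      then have "\<not> eventually (\<lambda>_. False) (Inf C)"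
        using CS unfolding eventually_False by blast
      then have "Inf C \<noteq> bot" unfolding eventually_False .
      moreover have "Inf C \<le> G"
        using False CS by (metis (mono_tags, lifting) Inf_lower2 ex_in_conv mem_Collect_eq subsetD)
      ultimately show ?thesis by (auto intro: Inf_lower)
    qed
  qed
  then obtain U where U: "U \<noteq> bot" "U \<le> G" and max: "\<And>V. V \<noteq> bot \<Longrightarrow> V \<le> G \<Longrightarrow> V \<le> U \<Longrightarrow> V = U"
    by auto
  have "eventually P U \<or> eventually (\<lambda>x. \<not> P x) U" for P
  proof (rule disjCI)
    assume "\<not> eventually (\<lambda>x. \<not> P x) U"
    then have "inf U (principal {x. P x}) \<noteq> bot"
      by (simp add: trivial_limit_def eventually_inf_principal)
    then have "inf U (principal {x. P x}) = U"
      using U(2) by (intro max) (auto intro: le_infI1)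
    then have "U \<le> principal {x. P x}" by (metis inf.cobounded2)
    then show "eventually P U" by (simp add: le_principal)
  qed
  with U that show thesis by blast
qed

section \<open>Congruences and their classes\<close>

lemma congs_refl: "\<theta> \<in> congs A \<Longrightarrow> w \<in> lists A \<Longrightarrow> (w, w) \<in> \<theta>"
  by (auto simp: congs_def equiv_def refl_on_def)

lemma congs_sym: "\<theta> \<in> congs A \<Longrightarrow> (u, v) \<in> \<theta> \<Longrightarrow> (v, u) \<in> \<theta>"
  by (auto simp: congs_def equiv_def dest: symD)

lemma congs_trans: "\<theta> \<in> congs A \<Longrightarrow> (u, v) \<in> \<theta> \<Longrightarrow> (v, w) \<in> \<theta> \<Longrightarrow> (u, w) \<in> \<theta>"
  by (auto simp: congs_def equiv_def dest: transD)

lemma congs_append: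
  "\<theta> \<in> congs A \<Longrightarrow> (u, u') \<in> \<theta> \<Longrightarrow> (v, v') \<in> \<theta> \<Longrightarrow> (u @ v, u' @ v') \<in> \<theta>"
  by (auto simp: congs_def)

lemma congs_lists: "\<theta> \<in> congs A \<Longrightarrow> (u, v) \<in> \<theta> \<Longrightarrow> u \<in> lists A \<and> v \<in> lists A"
  using congs_equiv equiv_type by blast

lemma congs_class_eq_iff:
  "\<theta> \<in> congs A \<Longrightarrow> u \<in> lists A \<Longrightarrow> v \<in> lists A \<Longrightarrow> \<theta> `` {u} = \<theta> `` {v} \<longleftrightarrow> (u, v) \<in> \<theta>"
  using congs_equiv eq_equiv_class_iff by metis

text \<open>Several congruences below arise in this way: \<open>g\<close> records a finite amount of
  information, and its value on a product is determined by its values on the factors.\<close>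

lemma kernel_fin_congs:
  assumes "finite (g ` lists A)"
    and "\<And>u u' v v'. \<lbrakk>u \<in> lists A; u' \<in> lists A; v \<in> lists A; v' \<in> lists A; g u = g u'; g v = g v'\<rbrakk>
      \<Longrightarrow> g (u @ v) = g (u' @ v')"
  shows "{(u, v). u \<in> lists A \<and> v \<in> lists A \<and> g u = g v} \<in> fin_congs A"
proof -
  let ?K = "{(u, v). u \<in> lists A \<and> v \<in> lists A \<and> g u = g v}"
  have "equiv (lists A) ?K"
    by (auto simp: equiv_def refl_on_def sym_def trans_def simp del: in_lists_conv_set)
  moreover have "lists A // ?K \<subseteq> (\<lambda>y. {v \<in> lists A. g v = y}) ` g ` lists A"
  proof
    fix C assume "C \<in> lists A // ?K"
    then obtain u where "u \<in> lists A" "C = ?K `` {u}" by (rule quotientE)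
    then have "C = {v \<in> lists A. g v = g u}" by (auto simp del: in_lists_conv_set)
    then show "C \<in> (\<lambda>y. {v \<in> lists A. g v = y}) ` g ` lists A" using \<open>u \<in> _\<close> by blast
  qed
  then have "finite (lists A // ?K)"
    by (rule finite_subset) (use assms(1) in blast)
  moreover have "\<forall>u u' v v'. (u, u') \<in> ?K \<longrightarrow> (v, v') \<in> ?K \<longrightarrow> (u @ v, u' @ v') \<in> ?K"
    using assms(2) by (auto simp del: in_lists_conv_set)
  ultimately show ?thesis
    unfolding fin_congs_def congs_def by blast
qed

lemma profinite_mult:
  "x \<otimes>\<^bsub>profinite_monoid A\<^esub> y = (\<lambda>\<theta>\<in>fin_congs A. x \<theta> \<otimes>\<^bsub>quot_monoid A \<theta>\<^esub> y \<theta>)"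
  by (simp add: profinite_monoid_def product_group_def)

lemma profinite_mult_class:
  assumes "\<theta> \<in> fin_congs A" "u \<in> lists A" "v \<in> lists A" "x \<theta> = \<theta> `` {u}" "y \<theta> = \<theta> `` {v}"
  shows "(x \<otimes>\<^bsub>profinite_monoid A\<^esub> y) \<theta> = \<theta> `` {u @ v}"
  using assms by (simp add: profinite_mult mult_quot_monoid fin_congsD)

lemma profinite_class:
  assumes "x \<in> carrier (profinite_monoid A)" "\<theta> \<in> fin_congs A"
  obtains w where "w \<in> lists A" "x \<theta> = \<theta> `` {w}"
proof -
  have "x \<theta> \<in> lists A // \<theta>" using assms by (auto simp: carrier_profinite_monoid)
  then show thesis by (rule quotientE) (rule that)
qed

lemma profinite_eqI:
  assumes "x \<in> carrier (profinite_monoid A)" "y \<in> carrier (profinite_monoid A)"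
    and "\<And>\<theta>. \<theta> \<in> fin_congs A \<Longrightarrow> x \<theta> = y \<theta>"
  shows "x = y"
  using assms by (intro extensionalityI[of x "fin_congs A" y]) (auto simp: carrier_profinite_monoid PiE_def)

text \<open>The index set of the nets is the set of finite-index congruences itself, and \<open>ulim w\<close> is the
  limit of the net \<open>w\<close> of words along an ultrafilter that refines the filter of tails.\<close>

locale profinite_ultrafilter =
  fixes A :: "'a set" and U :: "('a list \<times> 'a list) set filter"
  assumes nontriv: "U \<noteq> bot"
    and fine: "\<phi> \<in> fin_congs A \<Longrightarrow> eventually (\<lambda>\<theta>. \<theta> \<in> fin_congs A \<and> \<theta> \<subseteq> \<phi>) U"
    and ultra: "eventually P U \<or> eventually (\<lambda>\<theta>. \<not> P \<theta>) U"
begin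

abbreviation M where "M \<equiv> profinite_monoid A"

definition ulim :: "(('a list \<times> 'a list) set \<Rightarrow> 'a list) \<Rightarrow> 'a profinite_word" where
  "ulim w = (\<lambda>\<phi>\<in>fin_congs A. {v \<in> lists A. eventually (\<lambda>\<theta>. (w \<theta>, v) \<in> \<phi>) U})"

lemma ev_fin: "eventually (\<lambda>\<theta>. \<theta> \<in> fin_congs A) U"
  using fine[OF fin_congs_total] by (rule eventually_mono) simp

lemma ulim_eqI:
  assumes "\<phi> \<in> fin_congs A" "eventually (\<lambda>\<theta>. (w \<theta>, v) \<in> \<phi>) U"
  shows "ulim w \<phi> = \<phi> `` {v}"
proof -
  note c = fin_congsD(1)[OF assms(1)]
  have "(v, v') \<in> \<phi>" if "eventually (\<lambda>\<theta>. (w \<theta>, v') \<in> \<phi>) U" for v'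
  proof -
    have "eventually (\<lambda>\<theta>. (v, v') \<in> \<phi>) U"
      using eventually_conj[OF assms(2) that]
      by (rule eventually_mono) (meson c congs_sym congs_trans)
    then show ?thesis using nontriv by (simp add: eventually_const)
  qed
  moreover have "eventually (\<lambda>\<theta>. (w \<theta>, v') \<in> \<phi>) U" if "(v, v') \<in> \<phi>" for v'
    using assms(2) by (rule eventually_mono) (use that c congs_trans in blast)
  ultimately have "ulim w \<phi> = {v' \<in> lists A. (v, v') \<in> \<phi>}"
    using assms(1) by (simp only: ulim_def restrict_apply') blast
  also have "\<dots> = \<phi> `` {v}" using congs_lists[OF c] by blast
  finally show ?thesis .
qed

text \<open>Compactness: if no class were hit eventually, the ultrafilter would eventually avoid
  each of the finitely many classes, hence all of them at once.\<close>

lemma ulim_class: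
  assumes "\<And>\<theta>. \<theta> \<in> fin_congs A \<Longrightarrow> w \<theta> \<in> lists A" "\<phi> \<in> fin_congs A"
  obtains v where "v \<in> lists A" "eventually (\<lambda>\<theta>. (w \<theta>, v) \<in> \<phi>) U" "ulim w \<phi> = \<phi> `` {v}"
proof -
  note c = fin_congsD(1)[OF assms(2)]
  have "\<exists>v\<in>lists A. eventually (\<lambda>\<theta>. (w \<theta>, v) \<in> \<phi>) U"
  proof (rule ccontr)
    assume n: "\<not> ?thesis"
    have "eventually (\<lambda>\<theta>. w \<theta> \<notin> C) U" if "C \<in> lists A // \<phi>" for C
    proof -
      obtain v where v: "v \<in> lists A" "C = \<phi> `` {v}" using \<open>C \<in> _\<close> by (rule quotientE)
      then have "\<not> eventually (\<lambda>\<theta>. (w \<theta>, v) \<in> \<phi>) U" using n by blast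
      then have "eventually (\<lambda>\<theta>. (w \<theta>, v) \<notin> \<phi>) U" using ultra by blast
      then show ?thesis by (rule eventually_mono) (use v c congs_sym in blast)
    qed
    then have "eventually (\<lambda>\<theta>. \<forall>C\<in>lists A // \<phi>. w \<theta> \<notin> C) U"
      using fin_congsD(2)[OF assms(2)] by (intro eventually_ball_finite) auto
    with ev_fin have "eventually (\<lambda>\<theta>. False) U"
    proof eventually_elim
      case (elim \<theta>)
      then have "w \<theta> \<in> lists A" using assms by blast
      then show ?case using elim congs_refl[OF c] by (metis Image_singleton_iff quotientI)
    qed
    then show False using nontriv by (simp add: eventually_const)
  qed
  then show thesis using ulim_eqI[OF assms(2)] that by blast
qed

lemma ulim_carrier:
  assumes "\<And>\<theta>. \<theta> \<in> fin_congs A \<Longrightarrow> w \<theta> \<in> lists A"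
  shows "ulim w \<in> carrier M"
proof -
  have "ulim w \<phi> \<in> lists A // \<phi>" if phi: "\<phi> \<in> fin_congs A" for \<phi>
  proof -
    obtain v where "v \<in> lists A" "eventually (\<lambda>\<theta>. (w \<theta>, v) \<in> \<phi>) U" "ulim w \<phi> = \<phi> `` {v}"
      using ulim_class[OF assms phi] .
    then show ?thesis by (simp only: quotientI)
  qed
  moreover have "ulim w \<theta> \<subseteq> ulim w \<phi>" if "\<theta> \<in> fin_congs A" "\<phi> \<in> fin_congs A" "\<theta> \<subseteq> \<phi>" for \<theta> \<phi>
  proof -
    have "eventually (\<lambda>\<psi>. (w \<psi>, v) \<in> \<phi>) U" if "eventually (\<lambda>\<psi>. (w \<psi>, v) \<in> \<theta>) U" for v
      using that by (rule eventually_mono) (use \<open>\<theta> \<subseteq> \<phi>\<close> in blast)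
    with that(1,2) show ?thesis unfolding ulim_def by auto
  qed
  moreover have "ulim w \<in> extensional (fin_congs A)" by (simp add: ulim_def)
  ultimately show ?thesis
    unfolding carrier_profinite_monoid PiE_def by blast
qed

lemma ulim_append:
  assumes u: "\<And>\<theta>. \<theta> \<in> fin_congs A \<Longrightarrow> u \<theta> \<in> lists A"
    and v: "\<And>\<theta>. \<theta> \<in> fin_congs A \<Longrightarrow> v \<theta> \<in> lists A"
  shows "ulim (\<lambda>\<theta>. u \<theta> @ v \<theta>) = ulim u \<otimes>\<^bsub>M\<^esub> ulim v"
proof (rule profinite_eqI)
  interpret monoid M by (rule profinite_monoid_is_monoid)
  show "ulim (\<lambda>\<theta>. u \<theta> @ v \<theta>) \<in> carrier M" by (rule ulim_carrier) (use u v in auto)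
  show "ulim u \<otimes>\<^bsub>M\<^esub> ulim v \<in> carrier M" using u v by (intro m_closed ulim_carrier)
  fix \<phi> assume phi: "\<phi> \<in> fin_congs A"
  note c = fin_congsD(1)[OF phi]
  obtain u' where u': "u' \<in> lists A" "eventually (\<lambda>\<theta>. (u \<theta>, u') \<in> \<phi>) U" "ulim u \<phi> = \<phi> `` {u'}"
    using ulim_class[OF u phi] .
  obtain v' where v': "v' \<in> lists A" "eventually (\<lambda>\<theta>. (v \<theta>, v') \<in> \<phi>) U" "ulim v \<phi> = \<phi> `` {v'}"
    using ulim_class[OF v phi] .
  have "eventually (\<lambda>\<theta>. (u \<theta> @ v \<theta>, u' @ v') \<in> \<phi>) U"
    using eventually_conj[OF u'(2) v'(2)] by (rule eventually_mono) (use congs_append[OF c] in blast)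
  then show "ulim (\<lambda>\<theta>. u \<theta> @ v \<theta>) \<phi> = (ulim u \<otimes>\<^bsub>M\<^esub> ulim v) \<phi>"
    using u' v' phi by (simp add: ulim_eqI profinite_mult_class)
qed

text \<open>This is why congruences index the nets: a representative of \<open>x \<theta>\<close>
  placed at index \<open>\<theta>\<close> lies in \<open>x \<phi>\<close> as soon as
  \<open>\<theta> \<subseteq> \<phi>\<close>, which holds eventually.\<close>

lemma ulim_eq_of_approx:
  assumes x: "x \<in> carrier M" and w: "\<And>\<theta>. \<theta> \<in> fin_congs A \<Longrightarrow> w \<theta> \<in> x \<theta>"
  shows "ulim w = x"
proof (rule profinite_eqI[OF ulim_carrier x])
  show "w \<theta> \<in> lists A" if t: "\<theta> \<in> fin_congs A" for \<theta>
    by (rule profinite_class[OF x t]) (use w[OF t] congs_lists[OF fin_congsD(1)[OF t]] in blast)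
  fix \<phi> assume phi: "\<phi> \<in> fin_congs A"
  note c = fin_congsD(1)[OF phi]
  obtain v where v: "v \<in> lists A" "x \<phi> = \<phi> `` {v}" using profinite_class[OF x phi] .
  have "eventually (\<lambda>\<theta>. (w \<theta>, v) \<in> \<phi>) U"
    using fine[OF phi]
  proof (rule eventually_mono)
    fix \<theta> assume "\<theta> \<in> fin_congs A \<and> \<theta> \<subseteq> \<phi>"
    then have "w \<theta> \<in> x \<theta>" "x \<theta> \<subseteq> x \<phi>" using w phi x by (simp_all add: carrier_profinite_monoid)
    then have "w \<theta> \<in> x \<phi>" by blast
    then show "(w \<theta>, v) \<in> \<phi>" using v congs_sym[OF c] by blast
  qed
  then show "ulim w \<phi> = x \<phi>" using v phi by (simp add: ulim_eqI)
qed

text \<open>The modulus is the index itself, so a relation solved separately in every finite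
  quotient becomes an exact equation in the limit. Idempotents and factorizations are obtained in
  this way.\<close>

lemma ulim_cong:
  assumes w: "\<And>\<theta>. \<theta> \<in> fin_congs A \<Longrightarrow> (w \<theta>, w' \<theta>) \<in> \<theta>"
  shows "ulim w = ulim w'"
proof (rule profinite_eqI)
  have l: "w \<theta> \<in> lists A" "w' \<theta> \<in> lists A" if "\<theta> \<in> fin_congs A" for \<theta>
    using congs_lists[OF fin_congsD(1)[OF that] w[OF that]] by auto
  then show "ulim w \<in> carrier M" "ulim w' \<in> carrier M" by (simp_all only: ulim_carrier)
  fix \<phi> assume phi: "\<phi> \<in> fin_congs A"
  note c = fin_congsD(1)[OF phi]
  obtain v where v: "v \<in> lists A" "eventually (\<lambda>\<theta>. (w \<theta>, v) \<in> \<phi>) U" "ulim w \<phi> = \<phi> `` {v}"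
    using ulim_class[OF l(1) phi] .
  have "eventually (\<lambda>\<theta>. (w' \<theta>, v) \<in> \<phi>) U"
    using eventually_conj[OF fine[OF phi] v(2)]
    by (rule eventually_mono) (meson c congs_sym congs_trans subsetD w)
  then show "ulim w \<phi> = ulim w' \<phi>" using v phi by (simp add: ulim_eqI)
qed

lemma ulim_in_closure:
  assumes "L \<subseteq> lists A" and w: "\<And>\<theta>. \<theta> \<in> fin_congs A \<Longrightarrow> w \<theta> \<in> L"
  shows "ulim w \<in> profinite_closure A L"
proof -
  have l: "w \<theta> \<in> lists A" if "\<theta> \<in> fin_congs A" for \<theta> using assms that by blast
  have "\<exists>v\<in>L. ulim w \<phi> = \<phi> `` {v}" if phi: "\<phi> \<in> fin_congs A" for \<phi>
  proof -
    note c = fin_congsD(1)[OF phi]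
    obtain v where v: "v \<in> lists A" "eventually (\<lambda>\<theta>. (w \<theta>, v) \<in> \<phi>) U" "ulim w \<phi> = \<phi> `` {v}"
      using ulim_class[OF l phi] .
    obtain \<theta> where "\<theta> \<in> fin_congs A" "(w \<theta>, v) \<in> \<phi>"
      using eventually_happens'[OF nontriv eventually_conj[OF ev_fin v(2)]] by blast
    then show ?thesis using w v(1,3) l congs_class_eq_iff[OF c] by metis
  qed
  then show ?thesis
    using in_profinite_closure_iff[OF assms(1)] ulim_carrier[of w, OF l] by blast
qed

end

text \<open>The tails form a filter base because \<open>fin_congs A\<close> is closed under
  intersection; each tail contains the congruence that defines it, so the generated filter is
  proper.\<close>

lemma profinite_ultrafilter_exists:
  fixes A :: "'a set"
  obtains U where "profinite_ultrafilter A U"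
proof -
  let ?G = "INF \<phi>\<in>fin_congs A. principal {\<theta> \<in> fin_congs A. \<theta> \<subseteq> \<phi>}"
  have ev: "eventually P ?G \<longleftrightarrow> (\<exists>\<phi>\<in>fin_congs A. eventually P (principal {\<theta> \<in> fin_congs A. \<theta> \<subseteq> \<phi>}))" for P
  proof (rule eventually_INF_base)
    show "fin_congs A \<noteq> {}" using fin_congs_total by blast
    show "\<exists>x\<in>fin_congs A. principal {\<theta> \<in> fin_congs A. \<theta> \<subseteq> x}
        \<le> inf (principal {\<theta> \<in> fin_congs A. \<theta> \<subseteq> a}) (principal {\<theta> \<in> fin_congs A. \<theta> \<subseteq> b})"
      if "a \<in> fin_congs A" "b \<in> fin_congs A" for a b
      using fin_congs_Int[OF that] by (intro bexI[of _ "a \<inter> b"]) auto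
  qed
  have "?G \<noteq> bot"
    by (auto simp: trivial_limit_def ev eventually_principal)
  then obtain U where U: "U \<le> ?G" "U \<noteq> bot" "\<And>P. eventually P U \<or> eventually (\<lambda>x. \<not> P x) U"
    by (rule ultrafilter_exists) blast
  moreover have "eventually (\<lambda>\<theta>. \<theta> \<in> fin_congs A \<and> \<theta> \<subseteq> \<phi>) ?G" if "\<phi> \<in> fin_congs A" for \<phi>
    unfolding ev eventually_principal using that by blast
  ultimately have "profinite_ultrafilter A U"
    by unfold_locales (use U filter_leD[OF U(1)] in blast)+
  then show thesis by (rule that)
qed


section \<open>Rational languages have finite syntactic monoids\<close>

lemma star_Nil: "[] \<in> star X"
  unfolding star_def by (rule image_eqI[of _ _ "[]"]) simp_all

lemma star_append:
  assumes "u \<in> star X" "v \<in> star X"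
  shows "u @ v \<in> star X"
proof -
  obtain us vs where "us \<in> lists X" "u = concat us" "vs \<in> lists X" "v = concat vs"
    using assms unfolding star_def by blast
  then show ?thesis unfolding star_def by (intro image_eqI[of _ _ "us @ vs"]) simp_all
qed

lemma star_single: "x \<in> X \<Longrightarrow> x \<in> star X"
  unfolding star_def using image_eqI[of x concat "[x]"] by simp

lemma star_induct [consumes 1, case_names Nil append]:
  assumes "w \<in> star X" "P []" "\<And>x w. x \<in> X \<Longrightarrow> w \<in> star X \<Longrightarrow> P w \<Longrightarrow> P (x @ w)"
  shows "P w"
proof -
  obtain xs where "xs \<in> lists X" "w = concat xs" using assms(1) by (auto simp: star_def)
  moreover have "P (concat xs)" if "xs \<in> lists X" for xs
    using that by (induction xs) (use assms(2,3) in \<open>auto simp: star_def\<close>)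
  ultimately show ?thesis by blast
qed

lemma star_mono: "X \<subseteq> Y \<Longrightarrow> star X \<subseteq> star Y"
  unfolding star_def using lists_mono by blast

lemma star_lists: "X \<subseteq> lists A \<Longrightarrow> star X \<subseteq> lists A"
proof
  fix w assume "X \<subseteq> lists A" "w \<in> star X"
  then show "w \<in> lists A" by (induction rule: star_induct[OF \<open>w \<in> star X\<close>]) auto
qed

text \<open>A cut falls inside at most one factor \<open>m @ m'\<close> from \<open>X\<close>. The
  alternative \<open>[]\<close> is reached when the factors are exhausted before the cut.\<close>

lemma star_splitE:
  assumes "p @ q \<in> star X"
  obtains k m m' l where "p = k @ m" "q = m' @ l" "k \<in> star X" "l \<in> star X" "m @ m' \<in> insert [] X"
proof -
  have H: "\<forall>p q. w = p @ q \<longrightarrow> (\<exists>k m m' l. p = k @ m \<and> q = m' @ l \<and> k \<in> star X \<and> l \<in> star X \<and>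
      m @ m' \<in> insert [] X)" if "w \<in> star X" for w
    using that
  proof (induction rule: star_induct)
    case Nil
    then show ?case using star_Nil by auto
  next
    case (append x w)
    show ?case
    proof (intro allI impI)
      fix p q assume "x @ w = p @ q"
      then consider t where "p = x @ t" "w = t @ q" | t where "x = p @ t" "q = t @ w"
        by (auto simp: append_eq_append_conv2)
      then show "\<exists>k m m' l. p = k @ m \<and> q = m' @ l \<and> k \<in> star X \<and> l \<in> star X \<and> m @ m' \<in> insert [] X"
      proof cases
        case 1
        then obtain k m m' l where "t = k @ m" "q = m' @ l" "k \<in> star X" "l \<in> star X"
          "m @ m' \<in> insert [] X" using append.IH by blast
        moreover have "x @ k \<in> star X" using star_append star_single append \<open>k \<in> star X\<close> by blast
        ultimately show ?thesis using 1 by (metis append.assoc)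
      next
        case 2
        then show ?thesis using append star_Nil by (metis append.left_neutral insertI2)
      qed
    qed
  qed
  obtain k m m' l where "p = k @ m" "q = m' @ l" "k \<in> star X" "l \<in> star X" "m @ m' \<in> insert [] X"
    using H[OF assms, rule_format, OF refl] by blast
  then show thesis by (rule that)
qed

section \<open>Congruences adapted to concatenation and star\<close>

definition saturates :: "('a list \<times> 'a list) set \<Rightarrow> 'a list set \<Rightarrow> bool" where
  "saturates \<theta> L \<longleftrightarrow> (\<forall>(u, v)\<in>\<theta>. u \<in> L \<longleftrightarrow> v \<in> L)"

lemma saturatesD: "saturates \<theta> L \<Longrightarrow> (u, v) \<in> \<theta> \<Longrightarrow> u \<in> L \<longleftrightarrow> v \<in> L"
  by (auto simp: saturates_def)

lemma saturates_mono: "saturates \<phi> L \<Longrightarrow> \<theta> \<subseteq> \<phi> \<Longrightarrow> saturates \<theta> L"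
  by (auto simp: saturates_def)

text \<open>Both concatenation and star require control over where a word can be cut, so the
  invariant keeps the classes of the two contexts around each factor from
  \<open>star L\<close>.\<close>

definition star_factors :: "('a list \<times> 'a list) set \<Rightarrow> 'a list set \<Rightarrow> 'a list \<Rightarrow> ('a list set \<times> 'a list set) set" where
  "star_factors \<theta> L s = {(\<theta> `` {p}, \<theta> `` {r}) | p q r. s = p @ q @ r \<and> q \<in> star L}"

text \<open>For \<open>L = {}\<close> only the factorizations with \<open>q = []\<close> remain, and the following is the congruence
  of the Schuetzenberger product.\<close>

definition star_cong :: "'a set \<Rightarrow> ('a list \<times> 'a list) set \<Rightarrow> 'a list set \<Rightarrow> ('a list \<times> 'a list) set" where
  "star_cong A \<theta> L = {(u, v). u \<in> lists A \<and> v \<in> lists A \<and>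
     (\<theta> `` {u}, star_factors \<theta> L u) = (\<theta> `` {v}, star_factors \<theta> L v)}"

text \<open>A factor of \<open>s @ t\<close> in \<open>star L\<close> lies in \<open>s\<close>, lies
  in \<open>t\<close>, or crosses the boundary. In the last case the boundary cuts at most one
  factor from \<open>L\<close>, and saturation allows its two halves to be replaced by congruent
  ones.\<close>

lemma star_factors_append_subset:
  assumes c: "\<theta> \<in> congs A" and sat: "saturates \<theta> L" "saturates \<theta> {[]}"
    and l: "s \<in> lists A" "s' \<in> lists A" "t \<in> lists A" "t' \<in> lists A"
    and e: "\<theta> `` {s} = \<theta> `` {s'}" "\<theta> `` {t} = \<theta> `` {t'}"
    and f: "star_factors \<theta> L s = star_factors \<theta> L s'" "star_factors \<theta> L t = star_factors \<theta> L t'"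
  shows "star_factors \<theta> L (s @ t) \<subseteq> star_factors \<theta> L (s' @ t')"
proof clarify
  have st: "(s, s') \<in> \<theta>" "(t, t') \<in> \<theta>"
    using e l congs_class_eq_iff[OF c] by blast+
  have trn: "\<exists>p' q' r'. y = p' @ q' @ r' \<and> q' \<in> star L \<and> (p, p') \<in> \<theta> \<and> (r, r') \<in> \<theta>"
    if "star_factors \<theta> L x = star_factors \<theta> L y" "x = p @ q @ r" "q \<in> star L"
      "x \<in> lists A" "y \<in> lists A" for x y p q r
  proof -
    have "(\<theta> `` {p}, \<theta> `` {r}) \<in> star_factors \<theta> L y"
      using that(1-3) unfolding star_factors_def by blast
    then obtain p' q' r' where "\<theta> `` {p} = \<theta> `` {p'}" "\<theta> `` {r} = \<theta> `` {r'}"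
      "y = p' @ q' @ r'" "q' \<in> star L" unfolding star_factors_def by blast
    then show ?thesis
      using congs_class_eq_iff[OF c, of p p'] congs_class_eq_iff[OF c, of r r'] that(2,4,5) by auto
  qed
  have ins: "\<exists>p' q' r'. s' @ t' = p' @ q' @ r' \<and> q' \<in> star L \<and> (p, p') \<in> \<theta> \<and> (r, r') \<in> \<theta>"
    if pqr: "s @ t = p @ q @ r" and q: "q \<in> star L" for p q r
  proof -
    consider (right) h where "p = s @ h" "t = h @ q @ r"
      | (left) h where "s = p @ q @ h" "r = h @ t"
      | (mid) q1 q2 where "s = p @ q1" "q = q1 @ q2" "t = q2 @ r"
      using pqr by (fastforce simp: append_eq_append_conv2)
    then show ?thesis
    proof cases
      case right
      obtain h' q' r' where 1: "t' = h' @ q' @ r'" "q' \<in> star L" "(h, h') \<in> \<theta>" "(r, r') \<in> \<theta>"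
        using trn[OF f(2) right(2) q l(3,4)] by blast
      have "s' @ t' = (s' @ h') @ q' @ r'" "(p, s' @ h') \<in> \<theta>"
        using 1 right st congs_append[OF c] by auto
      with 1 show ?thesis by blast
    next
      case left
      obtain p' q' h' where 1: "s' = p' @ q' @ h'" "q' \<in> star L" "(p, p') \<in> \<theta>" "(h, h') \<in> \<theta>"
        using trn[OF f(1) left(1) q l(1,2)] by blast
      have "s' @ t' = p' @ q' @ h' @ t'" "(r, h' @ t') \<in> \<theta>"
        using 1 left st congs_append[OF c] by auto
      with 1 show ?thesis by blast
    next
      case mid
      \<comment> \<open>\<open>k\<close> and \<open>j\<close> are the parts of \<open>q\<close> in
        \<open>star L\<close> on either side of the boundary. The halves \<open>m\<close> and
        \<open>m'\<close> are treated as inner contexts of \<open>k\<close> and \<open>j\<close>, so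
        their classes are preserved.\<close>
      obtain k m m' j where k: "q1 = k @ m" "q2 = m' @ j" "k \<in> star L" "j \<in> star L"
        "m @ m' \<in> insert [] L" using star_splitE q mid(2) by metis
      obtain p' k' n where 1: "s' = p' @ k' @ n" "k' \<in> star L" "(p, p') \<in> \<theta>" "(m, n) \<in> \<theta>"
        using trn[OF f(1) _ k(3) l(1,2), of p m] mid k by auto
      obtain n' j' r' where 2: "t' = n' @ j' @ r'" "j' \<in> star L" "(m', n') \<in> \<theta>" "(r, r') \<in> \<theta>"
        using trn[OF f(2) _ k(4) l(3,4), of m' r] mid k by auto
      have "(m @ m', n @ n') \<in> \<theta>" using 1 2 congs_append[OF c] by blast
      then have "n @ n' \<in> insert [] L"
        using k(5) saturatesD[OF sat(1)] saturatesD[OF sat(2)] unfolding insert_iff by blast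
      then have "n @ n' \<in> star L"
      proof (rule insertE)
        assume "n @ n' = []"
        then show ?thesis using star_Nil by (rule ssubst)
      qed (rule star_single)
      then have "k' @ (n @ n') @ j' \<in> star L" by (rule star_append[OF 1(2) star_append[OF _ 2(2)]])
      moreover have "s' @ t' = p' @ (k' @ (n @ n') @ j') @ r'" using 1 2 by simp
      ultimately show ?thesis using 1(3) 2(4) by blast
    qed
  qed
  fix C D assume "(C, D) \<in> star_factors \<theta> L (s @ t)"
  then obtain p q r where "C = \<theta> `` {p}" "D = \<theta> `` {r}" "s @ t = p @ q @ r" "q \<in> star L"
    unfolding star_factors_def by blast
  moreover from this obtain p' q' r' where "s' @ t' = p' @ q' @ r'" "q' \<in> star L" "(p, p') \<in> \<theta>"
    "(r, r') \<in> \<theta>" using ins by blast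
  moreover from this have "\<theta> `` {p} = \<theta> `` {p'}" "\<theta> `` {r} = \<theta> `` {r'}"
    using congs_class_eq_iff[OF c] congs_lists[OF c] by metis+
  ultimately show "(C, D) \<in> star_factors \<theta> L (s' @ t')"
    unfolding star_factors_def by blast
qed

text \<open>The index is finite because \<open>star_factors\<close> takes its values among the
  subsets of a finite set; compatibility with concatenation is the preceding inclusion used in both
  directions.\<close>

lemma star_cong_fin_congs:
  assumes t: "\<theta> \<in> fin_congs A" and sat: "saturates \<theta> L" "saturates \<theta> {[]}"
  shows "star_cong A \<theta> L \<in> fin_congs A"
  unfolding star_cong_def
proof (rule kernel_fin_congs)
  note c = fin_congsD(1)[OF t]
  let ?Q = "lists A // \<theta>"
  have "star_factors \<theta> L s \<subseteq> ?Q \<times> ?Q" if "s \<in> lists A" for s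
    using that unfolding star_factors_def by (auto intro!: quotientI simp del: in_lists_conv_set)
  then have "(\<lambda>s. (\<theta> `` {s}, star_factors \<theta> L s)) ` lists A \<subseteq> ?Q \<times> Pow (?Q \<times> ?Q)"
    using quotientI[of _ "lists A" \<theta>] by blast
  then show "finite ((\<lambda>s. (\<theta> `` {s}, star_factors \<theta> L s)) ` lists A)"
    by (rule finite_subset) (use fin_congsD(2)[OF t] in simp)
  fix u u' v v'
  assume l: "u \<in> lists A" "u' \<in> lists A" "v \<in> lists A" "v' \<in> lists A"
    and e: "(\<theta> `` {u}, star_factors \<theta> L u) = (\<theta> `` {u'}, star_factors \<theta> L u')"
      "(\<theta> `` {v}, star_factors \<theta> L v) = (\<theta> `` {v'}, star_factors \<theta> L v')"
  have "(u, u') \<in> \<theta>" "(v, v') \<in> \<theta>" using e l congs_class_eq_iff[OF c] by auto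
  then have "(u @ v, u' @ v') \<in> \<theta>" by (rule congs_append[OF c])
  then have "\<theta> `` {u @ v} = \<theta> `` {u' @ v'}" using congs_equiv[OF c] by (rule equiv_class_eq[rotated])
  moreover have "star_factors \<theta> L (u @ v) = star_factors \<theta> L (u' @ v')"
    using star_factors_append_subset[OF c sat l] star_factors_append_subset[OF c sat l(2,1,4,3)] e
    by (intro subset_antisym) auto
  ultimately show "(\<theta> `` {u @ v}, star_factors \<theta> L (u @ v)) = (\<theta> `` {u' @ v'}, star_factors \<theta> L (u' @ v'))"
    by simp
qed

lemma star_cong_factorization:
  assumes c: "\<theta> \<in> congs A" and "(p @ q @ r, s) \<in> star_cong A \<theta> L" "q \<in> star L"
  obtains p' q' r' where "s = p' @ q' @ r'" "q' \<in> star L" "(p, p') \<in> \<theta>" "(r, r') \<in> \<theta>"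
proof -
  have l: "p @ q @ r \<in> lists A" "s \<in> lists A" and "star_factors \<theta> L (p @ q @ r) = star_factors \<theta> L s"
    using assms(2) by (auto simp: star_cong_def simp del: in_lists_conv_set)
  then have "(\<theta> `` {p}, \<theta> `` {r}) \<in> star_factors \<theta> L s"
    using assms(3) unfolding star_factors_def by blast
  then obtain p' q' r' where "\<theta> `` {p} = \<theta> `` {p'}" "\<theta> `` {r} = \<theta> `` {r'}"
    "s = p' @ q' @ r'" "q' \<in> star L" unfolding star_factors_def by blast
  then show thesis
    using that congs_class_eq_iff[OF c, of p p'] congs_class_eq_iff[OF c, of r r'] l by auto
qed

lemma star_cong_subset: "\<theta> \<in> congs A \<Longrightarrow> star_cong A \<theta> L \<subseteq> \<theta>"
  unfolding star_cong_def using congs_class_eq_iff by fast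

lemma star_cong_sym: "(u, v) \<in> star_cong A \<theta> L \<Longrightarrow> (v, u) \<in> star_cong A \<theta> L"
  unfolding star_cong_def by auto

text \<open>A word of \<open>star L\<close> is a factor of itself with empty contexts. The congruent
  word has contexts congruent to \<open>[]\<close>, and separation of the empty word makes these
  empty.\<close>

lemma star_cong_saturates_star:
  assumes c: "\<theta> \<in> congs A" and "saturates \<theta> {[]}"
  shows "saturates (star_cong A \<theta> L) (star L)"
proof -
  have "v \<in> star L" if uv: "(u, v) \<in> star_cong A \<theta> L" and u: "u \<in> star L" for u v
  proof -
    obtain p q r where "v = p @ q @ r" "q \<in> star L" "([], p) \<in> \<theta>" "([], r) \<in> \<theta>"
      using star_cong_factorization[OF c, of "[]" u "[]" v L] uv u by auto
    moreover from this have "p = []" "r = []" using saturatesD[OF assms(2)] by blast+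
    ultimately show ?thesis by simp
  qed
  then show ?thesis using star_cong_sym unfolding saturates_def by blast
qed

lemma fin_congs_separating_Nil:
  obtains \<theta> where "\<theta> \<in> fin_congs A" "saturates \<theta> {[]}"
proof -
  let ?N = "{(u, v). u \<in> lists A \<and> v \<in> lists A \<and> (u = []) = (v = [])}"
  have N: "?N \<in> fin_congs A"
  proof (rule kernel_fin_congs)
    show "finite ((\<lambda>u. u = []) ` lists A)" by (rule finite_subset[of _ UNIV]) auto
  qed auto
  then show thesis by (rule that) (auto simp: saturates_def)
qed

text \<open>This says that multiplication in the free profinite monoid is an open map; it makes the closure
  of a factorial language factorial.\<close>

lemma open_multiplication:
  assumes "\<theta> \<in> fin_congs A"
  obtains \<phi> where "\<phi> \<in> fin_congs A" "\<phi> \<subseteq> \<theta>"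
    "\<And>p r s. (p @ r, s) \<in> \<phi> \<Longrightarrow> \<exists>p' r'. s = p' @ r' \<and> (p, p') \<in> \<theta> \<and> (r, r') \<in> \<theta>"
proof -
  obtain \<nu> where N: "\<nu> \<in> fin_congs A" "saturates \<nu> {[]}" by (rule fin_congs_separating_Nil)
  let ?T = "\<theta> \<inter> \<nu>"
  have T: "?T \<in> fin_congs A" using assms N(1) by (rule fin_congs_Int)
  have sat: "saturates ?T {}" "saturates ?T {[]}" using N(2) by (auto simp: saturates_def)
  have "\<exists>p' r'. s = p' @ r' \<and> (p, p') \<in> \<theta> \<and> (r, r') \<in> \<theta>" if "(p @ r, s) \<in> star_cong A ?T {}" for p r s
  proof -
    have "(p @ [] @ r, s) \<in> star_cong A ?T {}" using that by simp
    then obtain p' q' r' where "s = p' @ q' @ r'" "q' \<in> star {}" "(p, p') \<in> ?T" "(r, r') \<in> ?T"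
      by (rule star_cong_factorization[OF fin_congsD(1)[OF T] _ star_Nil])
    moreover from this have "q' = []" by (auto simp: star_def)
    ultimately show ?thesis by auto
  qed
  then show thesis
    using that[OF star_cong_fin_congs[OF T sat]] star_cong_subset[OF fin_congsD(1)[OF T]] by blast
qed

section \<open>Recognition of rational languages\<close>

text \<open>Induction on the rational expression: lifting cuts by \<open>open_multiplication\<close>
  handles products, and \<open>star_cong\<close> handles star after a refinement that separates the
  empty word.\<close>

lemma rational_saturated:
  assumes "rational A L"
  shows "L \<subseteq> lists A \<and> (\<exists>\<theta>\<in>fin_congs A. saturates \<theta> L)"
  using assms
proof induction
  case empty
  then show ?case using fin_congs_total by (auto simp: saturates_def)
next
  case eps
  then show ?case using fin_congs_separating_Nil by (metis empty_subsetI insert_subset lists.Nil)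
next
  case (letter a)
  \<comment> \<open>A product equals \<open>[a]\<close> iff one factor is \<open>[a]\<close> and the
    other is empty, so both tests have to be recorded.\<close>
  let ?g = "\<lambda>w. (w = [], w = [a])"
  have "{(u, v). u \<in> lists A \<and> v \<in> lists A \<and> ?g u = ?g v} \<in> fin_congs A"
  proof (rule kernel_fin_congs)
    show "finite (?g ` lists A)" by (rule finite_subset[of _ UNIV]) auto
  qed (auto simp: append_eq_Cons_conv)
  then show ?case using letter by (intro conjI bexI) (auto simp: saturates_def)
next
  case (union K L)
  then obtain \<theta> \<phi> where "\<theta> \<in> fin_congs A" "saturates \<theta> K" "\<phi> \<in> fin_congs A" "saturates \<phi> L" by blast
  then have "\<theta> \<inter> \<phi> \<in> fin_congs A" "saturates (\<theta> \<inter> \<phi>) (K \<union> L)"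
    by (auto simp: fin_congs_Int saturates_def)
  then show ?case using union by blast
next
  case (conc K L)
  then obtain \<theta> \<phi> where t: "\<theta> \<in> fin_congs A" "saturates \<theta> K" "\<phi> \<in> fin_congs A" "saturates \<phi> L" by blast
  let ?KL = "{u @ v |u v. u \<in> K \<and> v \<in> L}"
  obtain \<psi> where psi: "\<psi> \<in> fin_congs A"
    "\<And>p r s. (p @ r, s) \<in> \<psi> \<Longrightarrow> \<exists>p' r'. s = p' @ r' \<and> (p, p') \<in> \<theta> \<inter> \<phi> \<and> (r, r') \<in> \<theta> \<inter> \<phi>"
    using open_multiplication[OF fin_congs_Int[OF t(1,3)]] by metis
  have "y \<in> ?KL" if "(x, y) \<in> \<psi>" "x \<in> ?KL" for x y
  proof -
    obtain u v where "x = u @ v" "u \<in> K" "v \<in> L" using \<open>x \<in> ?KL\<close> by blast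
    moreover from this obtain u' v' where "y = u' @ v'" "(u, u') \<in> \<theta>" "(v, v') \<in> \<phi>"
      using psi(2) \<open>(x, y) \<in> \<psi>\<close> by blast
    ultimately show ?thesis using saturatesD[OF t(2)] saturatesD[OF t(4)] by blast
  qed
  then have "saturates \<psi> ?KL"
    using congs_sym[OF fin_congsD(1)[OF psi(1)]] unfolding saturates_def by blast
  moreover have "?KL \<subseteq> lists A" using conc append_in_lists_conv[of _ _ A] by blast
  ultimately show ?case using psi(1) by blast
next
  case (star L)
  then obtain \<theta> where t: "\<theta> \<in> fin_congs A" "saturates \<theta> L" by blast
  obtain \<nu> where n: "\<nu> \<in> fin_congs A" "saturates \<nu> {[]}" by (rule fin_congs_separating_Nil)
  have i: "\<theta> \<inter> \<nu> \<in> fin_congs A" "saturates (\<theta> \<inter> \<nu>) L" "saturates (\<theta> \<inter> \<nu>) {[]}"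
    using t n by (auto intro: fin_congs_Int saturates_mono)
  then show ?case
    using star_cong_fin_congs[OF i] star_cong_saturates_star[OF fin_congsD(1)[OF i(1)] i(3)] star
      star_lists[of L A] by blast
qed

text \<open>Any congruence that saturates \<open>L\<close> is contained in the syntactic one, which
  therefore inherits finite index.\<close>

lemma rational_synt_cong:
  assumes "rational A L"
  shows "synt_cong A L \<in> fin_congs A"
proof -
  obtain \<theta> where t: "\<theta> \<in> fin_congs A" "saturates \<theta> L" using rational_saturated[OF assms] by blast
  note c = fin_congsD(1)[OF t(1)]
  have "(u, v) \<in> synt_cong A L" if "(u, v) \<in> \<theta>" for u v
  proof -
    have "p @ u @ q \<in> L \<longleftrightarrow> p @ v @ q \<in> L" if "p \<in> lists A" "q \<in> lists A" for p q
      using \<open>(u, v) \<in> \<theta>\<close> that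
      by (intro saturatesD[OF t(2)] congs_append[OF c]) (auto intro: congs_refl[OF c])
    then show ?thesis using congs_lists[OF c that] by (simp add: synt_cong_def)
  qed
  then have "\<theta> \<subseteq> synt_cong A L" by auto
  then have "finite (lists A // synt_cong A L)"
    using finite_refines_finite[OF fin_congsD(2)[OF t(1)] _ congs_equiv[OF c] congs_equiv[OF synt_cong_congs]]
    by blast
  then show ?thesis by (simp add: fin_congs_def synt_cong_congs)
qed

section \<open>Closures of factorial languages\<close>

lemma profinite_closure_carrier:
  "L \<subseteq> lists A \<Longrightarrow> x \<in> profinite_closure A L \<Longrightarrow> x \<in> carrier (profinite_monoid A)"
  by (simp add: in_profinite_closure_iff)

text \<open>Modulo a fine congruence the product of \<open>x\<close>, \<open>y\<close> and
  \<open>z\<close> is represented by a word \<open>s\<close> of \<open>F\<close>. Lifting both cuts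
  to \<open>s\<close> yields a factor of \<open>s\<close> that represents \<open>y\<close>.\<close>

lemma profinite_closure_factorial:
  assumes F: "F \<subseteq> lists A" "factorial F"
    and car: "x \<in> carrier (profinite_monoid A)" "y \<in> carrier (profinite_monoid A)" "z \<in> carrier (profinite_monoid A)"
    and xyz: "x \<otimes>\<^bsub>profinite_monoid A\<^esub> y \<otimes>\<^bsub>profinite_monoid A\<^esub> z \<in> profinite_closure A F"
  shows "y \<in> profinite_closure A F"
proof -
  have "\<exists>w\<in>F. y \<theta> = \<theta> `` {w}" if t: "\<theta> \<in> fin_congs A" for \<theta>
  proof -
    \<comment> \<open>A product of three elements has two cuts, hence two refinements:
      \<open>\<phi>\<close> for the inner cut and \<open>\<psi>\<close> for the outer one.\<close>
    obtain \<phi> where phi: "\<phi> \<in> fin_congs A" "\<phi> \<subseteq> \<theta>"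
      "\<And>p r s. (p @ r, s) \<in> \<phi> \<Longrightarrow> \<exists>p' r'. s = p' @ r' \<and> (p, p') \<in> \<theta> \<and> (r, r') \<in> \<theta>"
      using open_multiplication[OF t] by metis
    obtain \<psi> where psi: "\<psi> \<in> fin_congs A" "\<psi> \<subseteq> \<phi>"
      "\<And>p r s. (p @ r, s) \<in> \<psi> \<Longrightarrow> \<exists>p' r'. s = p' @ r' \<and> (p, p') \<in> \<phi> \<and> (r, r') \<in> \<phi>"
      using open_multiplication[OF phi(1)] by metis
    obtain a where a: "a \<in> lists A" "x \<psi> = \<psi> `` {a}" using profinite_class[OF car(1) psi(1)] .
    obtain b where b: "b \<in> lists A" "y \<psi> = \<psi> `` {b}" using profinite_class[OF car(2) psi(1)] .
    obtain d where d: "d \<in> lists A" "z \<psi> = \<psi> `` {d}" using profinite_class[OF car(3) psi(1)] .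
    obtain s where s: "s \<in> F" "(x \<otimes>\<^bsub>profinite_monoid A\<^esub> y \<otimes>\<^bsub>profinite_monoid A\<^esub> z) \<psi> = \<psi> `` {s}"
      using xyz psi(1) in_profinite_closure_iff[OF F(1)] by blast
    have "\<psi> `` {(a @ b) @ d} = \<psi> `` {s}"
      using s(2) a b d profinite_mult_class[OF psi(1), of a b x y]
        profinite_mult_class[OF psi(1), of "a @ b" d _ z] by (metis append_in_lists_conv)
    then have "((a @ b) @ d, s) \<in> \<psi>"
      using congs_class_eq_iff[OF fin_congsD(1)[OF psi(1)], of "(a @ b) @ d" s] a(1) b(1) d(1) s(1) F(1)
      by (simp del: append_assoc add: subset_iff del: in_lists_conv_set)
    then obtain s1 s2 where "s = s1 @ s2" "(a @ b, s1) \<in> \<phi>" using psi(3) by blast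
    moreover from this obtain s3 s4 where "s1 = s3 @ s4" "(b, s4) \<in> \<theta>" using phi(3) by blast
    ultimately have "sublist s4 s" "(b, s4) \<in> \<theta>" by (auto simp: sublist_def)
    moreover have "y \<theta> = \<theta> `` {b}"
      using profinite_eq_if_subset[OF car(2) psi(1) t _ b(2,1)] phi(2) psi(2) by blast
    ultimately show ?thesis
      using s(1) F(2) equiv_class_eq[OF congs_equiv[OF fin_congsD(1)[OF t]]]
      unfolding factorial_def by metis
  qed
  with car show ?thesis by (simp add: in_profinite_closure_iff[OF F(1)])
qed


section \<open>Idempotents and the minimum ideal\<close>

definition wpow :: "'a list \<Rightarrow> nat \<Rightarrow> 'a list" where
  "wpow w n = concat (replicate n w)"

lemma wpow_0 [simp]: "wpow w 0 = []" and wpow_Suc: "wpow w (Suc n) = w @ wpow w n"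
  by (simp_all add: wpow_def)

lemma wpow_add: "wpow w (m + n) = wpow w m @ wpow w n"
  by (simp add: wpow_def replicate_add)

lemma wpow_Suc2: "wpow w (Suc n) = wpow w n @ w"
  using wpow_add[of w n 1] by (simp add: wpow_def)

lemma wpow_lists: "w \<in> lists A \<Longrightarrow> wpow w n \<in> lists A"
  by (induction n) (auto simp: wpow_Suc)

text \<open>Two powers of \<open>w\<close> fall into the same class, so the powers are periodic with
  period \<open>d\<close> from exponent \<open>i\<close> on. A positive multiple of \<open>d\<close>
  that is at least \<open>i\<close> gives an idempotent.\<close>

lemma idempotent_wpow:
  assumes t: "\<theta> \<in> fin_congs A" and w: "w \<in> lists A"
  obtains n where "n > 0" "(wpow w n, wpow w n @ wpow w n) \<in> \<theta>"
proof -
  note c = fin_congsD(1)[OF t]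
  have "\<not> inj (\<lambda>n. \<theta> `` {wpow w n})"
  proof
    assume "inj (\<lambda>n. \<theta> `` {wpow w n})"
    moreover have "range (\<lambda>n. \<theta> `` {wpow w n}) \<subseteq> lists A // \<theta>"
      using quotientI[OF wpow_lists[OF w]] by blast
    ultimately show False
      using fin_congsD(2)[OF t] by (meson finite_imageD finite_subset infinite_UNIV_nat)
  qed
  then obtain i d where d: "d > 0" "\<theta> `` {wpow w i} = \<theta> `` {wpow w (i + d)}"
    by (metis (no_types, lifting) add.commute injI less_imp_add_positive linorder_neqE_nat)
  have i: "(wpow w i, wpow w (i + d)) \<in> \<theta>"
    using d(2) congs_class_eq_iff[OF c wpow_lists[OF w] wpow_lists[OF w]] by blast
  have step: "(wpow w (i + j), wpow w (i + j + d)) \<in> \<theta>" for j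
    using congs_append[OF c i congs_refl[OF c wpow_lists[OF w, of j]]]
    by (simp flip: wpow_add add: ac_simps)
  have per: "(wpow w (i + j), wpow w (i + j + k * d)) \<in> \<theta>" for j k
  proof (induction k)
    case 0
    then show ?case using congs_refl[OF c wpow_lists[OF w]] by simp
  next
    case (Suc k)
    then show ?case using congs_trans[OF c _ step[of "j + k * d"]] by (simp add: ac_simps)
  qed
  \<comment> \<open>The factor \<open>i + 1\<close> makes this multiple of \<open>d\<close> at least
    \<open>i\<close>, and positive even for \<open>i = 0\<close>.\<close>
  let ?n = "(i + 1) * d"
  have "?n \<ge> i" using d(1) by (cases d) auto
  then have "(wpow w ?n, wpow w (?n + ?n)) \<in> \<theta>" using per[of "?n - i" "i + 1"] by simp
  then show thesis using that[of ?n] d(1) by (simp add: wpow_add)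
qed

lemma wpow_iterate:
  assumes c: "\<theta> \<in> congs A" and x: "(x, a @ x @ b) \<in> \<theta>"
  shows "(x, wpow a n @ x @ wpow b n) \<in> \<theta>"
proof (induction n)
  case 0
  then show ?case using congs_lists[OF c x] congs_refl[OF c] by simp
next
  case (Suc n)
  have l: "a \<in> lists A" "b \<in> lists A" using congs_lists[OF c x] by auto
  have "(a @ x @ b, a @ (wpow a n @ x @ wpow b n) @ b) \<in> \<theta>"
    using Suc l by (intro congs_append[OF c] congs_refl[OF c]) auto
  moreover have "a @ (wpow a n @ x @ wpow b n) @ b = wpow a (Suc n) @ x @ wpow b (Suc n)"
    unfolding wpow_Suc[of a] wpow_Suc2[of b] by simp
  ultimately show ?case using congs_trans[OF c x] by metis
qed

text \<open>Iterating the relation up to an exponent at which \<open>wpow b n\<close> is idempotent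
  shows that appending another \<open>wpow b n\<close> changes nothing. This is the source of
  stability in finite monoids.\<close>

lemma wpow_absorb_right:
  assumes t: "\<theta> \<in> fin_congs A" and x: "(x, a @ x @ b) \<in> \<theta>"
  obtains n where "n > 0" "(wpow b n, wpow b n @ wpow b n) \<in> \<theta>" "(x, x @ wpow b n) \<in> \<theta>"
proof -
  note c = fin_congsD(1)[OF t]
  have l: "a \<in> lists A" "x \<in> lists A" "b \<in> lists A" using congs_lists[OF c x] by auto
  obtain n where n: "n > 0" "(wpow b n, wpow b n @ wpow b n) \<in> \<theta>"
    using idempotent_wpow[OF t l(3)] .
  have 1: "(x, wpow a n @ x @ wpow b n) \<in> \<theta>" using wpow_iterate[OF c x] .
  have "(wpow a n @ x @ wpow b n, wpow a n @ x @ wpow b n @ wpow b n) \<in> \<theta>"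
    using n l wpow_lists[OF l(1)] by (intro congs_append[OF c] congs_refl[OF c])
  moreover have "(x @ wpow b n, (wpow a n @ x @ wpow b n) @ wpow b n) \<in> \<theta>"
    using 1 wpow_lists[OF l(3)] by (intro congs_append[OF c] congs_refl[OF c])
  ultimately have "(x, x @ wpow b n) \<in> \<theta>"
    using congs_trans[OF c] congs_sym[OF c] 1 by (metis append.assoc)
  with n that show thesis by blast
qed

lemma wpow_absorb_left:
  assumes t: "\<theta> \<in> fin_congs A" and x: "(x, a @ x @ b) \<in> \<theta>"
  obtains n where "n > 0" "(x, wpow a n @ x) \<in> \<theta>"
proof -
  note c = fin_congsD(1)[OF t]
  have l: "a \<in> lists A" "x \<in> lists A" "b \<in> lists A" using congs_lists[OF c x] by auto
  obtain n where n: "n > 0" "(wpow a n, wpow a n @ wpow a n) \<in> \<theta>"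
    using idempotent_wpow[OF t l(1)] .
  have 1: "(x, wpow a n @ x @ wpow b n) \<in> \<theta>" using wpow_iterate[OF c x] .
  have "(wpow a n @ x @ wpow b n, (wpow a n @ wpow a n) @ x @ wpow b n) \<in> \<theta>"
    using n l wpow_lists[OF l(3)] by (intro congs_append[OF c] congs_refl[OF c])
  moreover have "(wpow a n @ x, wpow a n @ (wpow a n @ x @ wpow b n)) \<in> \<theta>"
    using 1 wpow_lists[OF l(1)] by (intro congs_append[OF c] congs_refl[OF c])
  ultimately have "(x, wpow a n @ x) \<in> \<theta>"
    using congs_trans[OF c] congs_sym[OF c] 1 by (metis append.assoc)
  with n that show thesis by blast
qed

section \<open>Green's relations and conjugate idempotents\<close>

context monoid
begin

lemma J_le_trans:
  assumes "J_le G x y" "J_le G y z" "z \<in> carrier G"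
  shows "J_le G x z"
proof -
  obtain a b c d where "a \<in> carrier G" "b \<in> carrier G" "c \<in> carrier G" "d \<in> carrier G"
    "x = a \<otimes> y \<otimes> b" "y = c \<otimes> z \<otimes> d" using assms(1,2) unfolding J_le_def by blast
  moreover from this have "x = (a \<otimes> c) \<otimes> z \<otimes> (d \<otimes> b)" using assms(3) by (simp add: m_assoc)
  ultimately show ?thesis unfolding J_le_def by blast
qed

lemma R_le_trans:
  assumes "R_le G x y" "R_le G y z" "z \<in> carrier G"
  shows "R_le G x z"
  using assms unfolding R_le_def by (metis m_assoc m_closed)

lemma L_le_trans:
  assumes "L_le G x y" "L_le G y z" "z \<in> carrier G"
  shows "L_le G x z"
  using assms unfolding L_le_def by (metis m_assoc m_closed)

lemma H_class_refl: "x \<in> carrier G \<Longrightarrow> x \<in> H_class G x"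
  unfolding H_class_def R_eq_def L_eq_def R_le_def L_le_def by (auto intro: bexI[of _ \<one>])

lemma H_class_trans:
  assumes "x \<in> carrier G" "e \<in> H_class G x" "k \<in> H_class G e"
  shows "k \<in> H_class G x"
proof -
  have "e \<in> carrier G" "k \<in> carrier G" using assms unfolding H_class_def by auto
  then show ?thesis
    using assms R_le_trans L_le_trans unfolding H_class_def R_eq_def L_eq_def by blast
qed

lemma maximal_subgroup_H_class:
  assumes "H \<in> maximal_subgroups G" "e \<in> H" "k \<in> H_class G e"
  shows "k \<in> H"
  using assms H_class_trans unfolding maximal_subgroups_def by auto

text \<open>An idempotent can be replaced by a conjugate, hence J-equivalent, idempotent that ends, or
  starts, with a prescribed factor of it.\<close>

lemma idempotent_with_suffix:
  assumes c: "e \<in> carrier G" "p \<in> carrier G" "v \<in> carrier G" "q \<in> carrier G"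
    and e: "e \<otimes> e = e" "e = p \<otimes> v \<otimes> q"
  shows "(q \<otimes> e \<otimes> p \<otimes> v) \<otimes> (q \<otimes> e \<otimes> p \<otimes> v) = q \<otimes> e \<otimes> p \<otimes> v"
    and "e = (p \<otimes> v) \<otimes> (q \<otimes> e \<otimes> p \<otimes> v) \<otimes> q"
proof -
  have "(q \<otimes> e \<otimes> p \<otimes> v) \<otimes> (q \<otimes> e \<otimes> p \<otimes> v) = q \<otimes> e \<otimes> (p \<otimes> v \<otimes> q) \<otimes> e \<otimes> (p \<otimes> v)"
    using c by (simp add: m_assoc)
  also have "\<dots> = q \<otimes> ((e \<otimes> e) \<otimes> e) \<otimes> (p \<otimes> v)" unfolding e(2)[symmetric] using c by (simp add: m_assoc)
  finally show "(q \<otimes> e \<otimes> p \<otimes> v) \<otimes> (q \<otimes> e \<otimes> p \<otimes> v) = q \<otimes> e \<otimes> p \<otimes> v"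
    using c by (simp add: e(1) m_assoc)
  have "(p \<otimes> v) \<otimes> (q \<otimes> e \<otimes> p \<otimes> v) \<otimes> q = (p \<otimes> v \<otimes> q) \<otimes> e \<otimes> (p \<otimes> v \<otimes> q)"
    using c by (simp add: m_assoc)
  then show "e = (p \<otimes> v) \<otimes> (q \<otimes> e \<otimes> p \<otimes> v) \<otimes> q"
    unfolding e(2)[symmetric] by (simp add: e(1))
qed

lemma idempotent_with_prefix:
  assumes c: "e \<in> carrier G" "p \<in> carrier G" "v \<in> carrier G" "q \<in> carrier G"
    and e: "e \<otimes> e = e" "e = p \<otimes> v \<otimes> q"
  shows "(v \<otimes> q \<otimes> e \<otimes> p) \<otimes> (v \<otimes> q \<otimes> e \<otimes> p) = v \<otimes> q \<otimes> e \<otimes> p"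
    and "e = p \<otimes> (v \<otimes> q \<otimes> e \<otimes> p) \<otimes> (v \<otimes> q)"
proof -
  have "(v \<otimes> q \<otimes> e \<otimes> p) \<otimes> (v \<otimes> q \<otimes> e \<otimes> p) = v \<otimes> q \<otimes> e \<otimes> (p \<otimes> v \<otimes> q) \<otimes> e \<otimes> p"
    using c by (simp add: m_assoc)
  also have "\<dots> = v \<otimes> q \<otimes> ((e \<otimes> e) \<otimes> e) \<otimes> p" unfolding e(2)[symmetric] using c by (simp add: m_assoc)
  finally show "(v \<otimes> q \<otimes> e \<otimes> p) \<otimes> (v \<otimes> q \<otimes> e \<otimes> p) = v \<otimes> q \<otimes> e \<otimes> p"
    using c by (simp add: e(1) m_assoc)
  have "p \<otimes> (v \<otimes> q \<otimes> e \<otimes> p) \<otimes> (v \<otimes> q) = (p \<otimes> v \<otimes> q) \<otimes> e \<otimes> (p \<otimes> v \<otimes> q)"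
    using c by (simp add: m_assoc)
  then show "e = p \<otimes> (v \<otimes> q \<otimes> e \<otimes> p) \<otimes> (v \<otimes> q)"
    unfolding e(2)[symmetric] by (simp add: e(1))
qed

end

section \<open>H-classes in the minimum ideal\<close>

text \<open>The ideal generated by \<open>k\<close> contains the minimum ideal, so \<open>e\<close>
  is congruent to some \<open>s @ k @ u\<close>. Inserting \<open>e\<close> next to \<open>k\<close>
  and applying absorption on either side exhibits \<open>e\<close> as a right and a left multiple of
  \<open>k\<close>.\<close>

lemma minimum_ideal_H_class:
  assumes t: "\<theta> \<in> fin_congs A" and l: "e \<in> lists A"
    and min: "\<theta> `` {e} \<in> minimum_ideal (quot_monoid A \<theta>)"
    and k: "(k, e @ k) \<in> \<theta>" "(k, k @ e) \<in> \<theta>"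
  shows "\<theta> `` {k} \<in> H_class (quot_monoid A \<theta>) (\<theta> `` {e})"
proof -
  let ?Q = "quot_monoid A \<theta>"
  note c = fin_congsD(1)[OF t]
  have car: "carrier ?Q = lists A // \<theta>" by (simp add: quot_monoid_def)
  have lk: "k \<in> lists A" using congs_lists[OF c k(1)] by blast
  note m = mult_quot_monoid[OF c]
  define I where "I = (\<lambda>(s, u). \<theta> `` {s @ k @ u}) ` (lists A \<times> lists A)"
  have I: "\<theta> `` {s @ k @ u} \<in> I" if "s \<in> lists A" "u \<in> lists A" for s u
    unfolding I_def using that by (intro image_eqI[of _ _ "(s, u)"]) simp_all
  have IE: "\<exists>s u. s \<in> lists A \<and> u \<in> lists A \<and> C = \<theta> `` {s @ k @ u}" if "C \<in> I" for C
    using that unfolding I_def image_iff by force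
  have "monoid_ideal ?Q I"
    unfolding monoid_ideal_def
  proof (intro conjI ballI)
    show "I \<subseteq> carrier ?Q"
    proof
      fix C assume "C \<in> I"
      then obtain s u where "s \<in> lists A" "u \<in> lists A" "C = \<theta> `` {s @ k @ u}" using IE by metis
      then show "C \<in> carrier ?Q" using lk by (simp add: car quotientI)
    qed
    show "I \<noteq> {}" using I[of "[]" "[]"] by (metis empty_iff lists.Nil)
    fix x y assume x: "x \<in> I" and y: "y \<in> carrier ?Q"
    obtain s u where s: "s \<in> lists A" "u \<in> lists A" "x = \<theta> `` {s @ k @ u}" using IE[OF x] by metis
    obtain w where w: "w \<in> lists A" "y = \<theta> `` {w}" using y unfolding car by (rule quotientE)
    have "y \<otimes>\<^bsub>?Q\<^esub> x = \<theta> `` {(w @ s) @ k @ u}" "x \<otimes>\<^bsub>?Q\<^esub> y = \<theta> `` {s @ k @ (u @ w)}"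
      unfolding s(3) w(2) using s w lk by (simp_all add: m)
    moreover have "w @ s \<in> lists A" "u @ w \<in> lists A" using w s by simp_all
    ultimately show "y \<otimes>\<^bsub>?Q\<^esub> x \<in> I" "x \<otimes>\<^bsub>?Q\<^esub> y \<in> I" using s(1,2) by (simp_all only: I)
  qed
  then have "\<theta> `` {e} \<in> I" using min unfolding minimum_ideal_def by blast
  then obtain s u where su: "s \<in> lists A" "u \<in> lists A" "\<theta> `` {e} = \<theta> `` {s @ k @ u}" using IE by metis
  then have esku: "(e, s @ k @ u) \<in> \<theta>" using congs_class_eq_iff[OF c, of e "s @ k @ u"] l lk by auto
  have ctx: "(s @ x @ u, s @ y @ u) \<in> \<theta>" if "(x, y) \<in> \<theta>" for x y
    using that su by (intro congs_append[OF c] congs_refl[OF c])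
  have "(e, s @ e @ (k @ u)) \<in> \<theta>"
    using congs_trans[OF c esku ctx[OF k(1)]] by simp
  then obtain n where n: "n > 0" "(e, e @ wpow (k @ u) n) \<in> \<theta>"
    by (rule wpow_absorb_right[OF t])
  \<comment> \<open>As \<open>n > 0\<close>, one \<open>k @ u\<close> splits off the power and
    \<open>e @ k\<close> collapses to \<open>k\<close>; \<open>y\<close> is what remains after this
    \<open>k\<close>. The mirror role is played by \<open>x\<close> below.\<close>
  define y where "y = u @ wpow (k @ u) (n - 1)"
  have ly: "y \<in> lists A" using su lk wpow_lists[of "k @ u" A] unfolding y_def by simp
  have "e @ wpow (k @ u) n = (e @ k) @ y" using n(1) wpow_Suc[of "k @ u" "n - 1"] by (simp add: y_def)
  moreover have "((e @ k) @ y, k @ y) \<in> \<theta>" using k(1) ly congs_sym[OF c] by (intro congs_append[OF c] congs_refl[OF c])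
  ultimately have eR: "(e, k @ y) \<in> \<theta>" using n(2) congs_trans[OF c] by metis
  have "(e, (s @ k) @ e @ u) \<in> \<theta>"
    using congs_trans[OF c esku ctx[OF k(2)]] by simp
  then obtain n' where n': "n' > 0" "(e, wpow (s @ k) n' @ e) \<in> \<theta>"
    by (rule wpow_absorb_left[OF t])
  define x where "x = wpow (s @ k) (n' - 1) @ s"
  have lx: "x \<in> lists A" using su lk wpow_lists[of "s @ k" A] unfolding x_def by simp
  have "wpow (s @ k) n' @ e = x @ (k @ e)" using n'(1) wpow_Suc2[of "s @ k" "n' - 1"] by (simp add: x_def)
  moreover have "(x @ (k @ e), x @ k) \<in> \<theta>" using k(2) lx congs_sym[OF c] by (intro congs_append[OF c] congs_refl[OF c])
  ultimately have eL: "(e, x @ k) \<in> \<theta>" using n'(2) congs_trans[OF c] by metis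
  have q: "\<theta> `` {w} \<in> carrier ?Q" if "w \<in> lists A" for w using that unfolding car by (rule quotientI)
  have eq: "\<theta> `` {w} = \<theta> `` {w'}" if "(w, w') \<in> \<theta>" for w w'
    using that congs_equiv[OF c] by (rule equiv_class_eq[rotated])
  have "\<theta> `` {k} = \<theta> `` {e} \<otimes>\<^bsub>?Q\<^esub> \<theta> `` {k}" "\<theta> `` {k} = \<theta> `` {k} \<otimes>\<^bsub>?Q\<^esub> \<theta> `` {e}"
    "\<theta> `` {e} = \<theta> `` {k} \<otimes>\<^bsub>?Q\<^esub> \<theta> `` {y}" "\<theta> `` {e} = \<theta> `` {x} \<otimes>\<^bsub>?Q\<^esub> \<theta> `` {k}"
    unfolding m[OF l lk] m[OF lk l] m[OF lk ly] m[OF lx lk]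
    by (fact eq[OF k(1)] eq[OF k(2)] eq[OF eR] eq[OF eL])+
  then show ?thesis
    unfolding H_class_def R_eq_def L_eq_def R_le_def L_le_def
    using q[OF lk] q[OF l] q[OF ly] q[OF lx] by blast
qed

section \<open>Recurrence in the profinite closure\<close>

lemma recurrent_contains_finite:
  assumes F: "recurrent A F" and "finite T" "T \<subseteq> F"
  shows "\<exists>s\<in>F. \<forall>v\<in>T. sublist v s"
  using assms(2,3)
proof (induction T)
  case empty
  then show ?case using F by (auto simp: recurrent_def subshift_language_def)
next
  case (insert v T)
  then obtain s where s: "s \<in> F" "\<forall>v\<in>T. sublist v s" by blast
  then obtain w where "v @ w @ s \<in> F" using F insert.prems unfolding recurrent_def by blast
  moreover have "sublist v (v @ w @ s)" "sublist s (v @ w @ s)"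
    by (auto simp: sublist_def) (metis append.assoc append.right_neutral)
  ultimately show ?case using s(2) sublist_order.order_trans by (metis insert_iff)
qed

context profinite_ultrafilter
begin

sublocale monoid M by (rule profinite_monoid_is_monoid)

lemma profinite_approx:
  assumes "x \<in> carrier M"
  obtains w where "\<And>\<theta>. \<theta> \<in> fin_congs A \<Longrightarrow> w \<theta> \<in> lists A"
    "\<And>\<theta>. \<theta> \<in> fin_congs A \<Longrightarrow> x \<theta> = \<theta> `` {w \<theta>}" "ulim w = x"
proof -
  have "\<forall>\<theta>\<in>fin_congs A. \<exists>w. w \<in> lists A \<and> x \<theta> = \<theta> `` {w}"
    using profinite_class[OF assms] by metis
  then obtain w where w: "\<forall>\<theta>\<in>fin_congs A. w \<theta> \<in> lists A \<and> x \<theta> = \<theta> `` {w \<theta>}"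
    by (rule bchoice[THEN exE])
  moreover have "w \<theta> \<in> x \<theta>" if "\<theta> \<in> fin_congs A" for \<theta>
    using w that congs_refl[OF fin_congsD(1)[OF that]] by blast
  ultimately show thesis using that ulim_eq_of_approx[OF assms, of w] by blast
qed

text \<open>Absorption modulo each \<open>\<theta>\<close> supplies an exponent
  \<open>n \<theta>\<close>; the limit of the corresponding powers of representatives of
  \<open>b\<close> is idempotent and fixes \<open>x\<close> on the right.\<close>

lemma idempotent_of_fixed_factorization:
  assumes car: "x \<in> carrier M" "a \<in> carrier M" "b \<in> carrier M" and eq: "x = a \<otimes>\<^bsub>M\<^esub> x \<otimes>\<^bsub>M\<^esub> b"
  obtains f c where "f \<in> carrier M" "c \<in> carrier M" "f \<otimes>\<^bsub>M\<^esub> f = f" "x \<otimes>\<^bsub>M\<^esub> f = x" "f = b \<otimes>\<^bsub>M\<^esub> c"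
proof -
  obtain u where u: "\<And>\<theta>. \<theta> \<in> fin_congs A \<Longrightarrow> u \<theta> \<in> lists A"
    "\<And>\<theta>. \<theta> \<in> fin_congs A \<Longrightarrow> x \<theta> = \<theta> `` {u \<theta>}" "ulim u = x"
    using profinite_approx[OF car(1)] by metis
  obtain v where v: "\<And>\<theta>. \<theta> \<in> fin_congs A \<Longrightarrow> v \<theta> \<in> lists A"
    "\<And>\<theta>. \<theta> \<in> fin_congs A \<Longrightarrow> a \<theta> = \<theta> `` {v \<theta>}" "ulim v = a"
    using profinite_approx[OF car(2)] by metis
  obtain w where w: "\<And>\<theta>. \<theta> \<in> fin_congs A \<Longrightarrow> w \<theta> \<in> lists A"
    "\<And>\<theta>. \<theta> \<in> fin_congs A \<Longrightarrow> b \<theta> = \<theta> `` {w \<theta>}" "ulim w = b"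
    using profinite_approx[OF car(3)] by metis
  have "\<forall>\<theta>\<in>fin_congs A. \<exists>n>0. (wpow (w \<theta>) n, wpow (w \<theta>) n @ wpow (w \<theta>) n) \<in> \<theta> \<and>
      (u \<theta>, u \<theta> @ wpow (w \<theta>) n) \<in> \<theta>"
  proof
    fix \<theta> assume t: "\<theta> \<in> fin_congs A"
    note c = fin_congsD(1)[OF t]
    have "(a \<otimes>\<^bsub>M\<^esub> x) \<theta> = \<theta> `` {v \<theta> @ u \<theta>}"
      using t u v by (intro profinite_mult_class) auto
    then have "(a \<otimes>\<^bsub>M\<^esub> x \<otimes>\<^bsub>M\<^esub> b) \<theta> = \<theta> `` {(v \<theta> @ u \<theta>) @ w \<theta>}"
      using t u v w by (intro profinite_mult_class) auto
    then have "\<theta> `` {u \<theta>} = \<theta> `` {v \<theta> @ u \<theta> @ w \<theta>}"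
      using eq u(2)[OF t] by (metis append.assoc)
    then have "(u \<theta>, v \<theta> @ u \<theta> @ w \<theta>) \<in> \<theta>"
      using congs_class_eq_iff[OF c, of "u \<theta>" "v \<theta> @ u \<theta> @ w \<theta>"] u(1)[OF t] v(1)[OF t] w(1)[OF t] by simp
    then show "\<exists>n>0. (wpow (w \<theta>) n, wpow (w \<theta>) n @ wpow (w \<theta>) n) \<in> \<theta> \<and>
        (u \<theta>, u \<theta> @ wpow (w \<theta>) n) \<in> \<theta>"
      by (rule wpow_absorb_right[OF t]) blast
  qed
  then obtain n where n: "\<forall>\<theta>\<in>fin_congs A. 0 < n \<theta> \<and>
      (wpow (w \<theta>) (n \<theta>), wpow (w \<theta>) (n \<theta>) @ wpow (w \<theta>) (n \<theta>)) \<in> \<theta> \<and>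
      (u \<theta>, u \<theta> @ wpow (w \<theta>) (n \<theta>)) \<in> \<theta>"
    by (rule bchoice[THEN exE])
  define f where "f = ulim (\<lambda>\<theta>. wpow (w \<theta>) (n \<theta>))"
  \<comment> \<open>The witness for the cofactor \<open>c\<close>: since \<open>n \<theta>\<close>
    is positive, prefixing one more \<open>w \<theta>\<close> restores the full power.\<close>
  define d where "d = ulim (\<lambda>\<theta>. wpow (w \<theta>) (n \<theta> - 1))"
  have lw: "wpow (w \<theta>) k \<in> lists A" if "\<theta> \<in> fin_congs A" for \<theta> k
    using w(1)[OF that] by (rule wpow_lists)
  have "f \<in> carrier M" "d \<in> carrier M" unfolding f_def d_def using lw by (intro ulim_carrier; simp)+
  moreover have "f \<otimes>\<^bsub>M\<^esub> f = ulim (\<lambda>\<theta>. wpow (w \<theta>) (n \<theta>) @ wpow (w \<theta>) (n \<theta>))"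
    unfolding f_def by (rule ulim_append[symmetric]) (rule lw, assumption)+
  then have "f \<otimes>\<^bsub>M\<^esub> f = f"
    using ulim_cong[of "\<lambda>\<theta>. wpow (w \<theta>) (n \<theta>)" "\<lambda>\<theta>. wpow (w \<theta>) (n \<theta>) @ wpow (w \<theta>) (n \<theta>)"] n
    by (simp add: f_def)
  moreover have "x \<otimes>\<^bsub>M\<^esub> f = ulim (\<lambda>\<theta>. u \<theta> @ wpow (w \<theta>) (n \<theta>))"
    unfolding f_def u(3)[symmetric] by (rule ulim_append[symmetric]) (use u(1) lw in blast)+
  then have "x \<otimes>\<^bsub>M\<^esub> f = x"
    using ulim_cong[of u "\<lambda>\<theta>. u \<theta> @ wpow (w \<theta>) (n \<theta>)"] n u(3) by simp
  moreover have "b \<otimes>\<^bsub>M\<^esub> d = ulim (\<lambda>\<theta>. w \<theta> @ wpow (w \<theta>) (n \<theta> - 1))"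
    unfolding d_def w(3)[symmetric] by (rule ulim_append[symmetric]) (use w(1) lw in blast)+
  then have "f = b \<otimes>\<^bsub>M\<^esub> d"
  proof (simp only: f_def, intro ulim_cong)
    fix \<theta> assume t: "\<theta> \<in> fin_congs A"
    then have "w \<theta> @ wpow (w \<theta>) (n \<theta> - 1) = wpow (w \<theta>) (n \<theta>)"
      using n wpow_Suc[of "w \<theta>" "n \<theta> - 1"] by simp
    then show "(wpow (w \<theta>) (n \<theta>), w \<theta> @ wpow (w \<theta>) (n \<theta> - 1)) \<in> \<theta>"
      using congs_refl[OF fin_congsD(1)[OF t] lw[OF t]] by metis
  qed
  ultimately show thesis by (rule that)
qed

text \<open>Modulo each \<open>\<theta>\<close> only finitely many classes meet \<open>F\<close>,
  and recurrence yields one word of \<open>F\<close> containing representatives of all of them. The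
  limit of these words has every element of the closure as a factor.\<close>

lemma closure_has_J_below:
  assumes F: "recurrent A F"
  obtains x where "x \<in> profinite_closure A F" "\<And>y. y \<in> profinite_closure A F \<Longrightarrow> J_le M x y"
proof -
  have FA: "F \<subseteq> lists A" and fac: "factorial F"
    using F by (auto simp: recurrent_def subshift_language_def)
  have "\<forall>\<theta>\<in>fin_congs A. \<exists>s. s \<in> F \<and> (\<forall>v\<in>F. \<exists>p q r. s = p @ q @ r \<and> (q, v) \<in> \<theta>)"
  proof
    fix \<theta> assume t: "\<theta> \<in> fin_congs A"
    note c = fin_congsD(1)[OF t]
    define D where "D = {C \<in> lists A // \<theta>. F \<inter> C \<noteq> {}}"
    have "\<forall>C\<in>D. \<exists>v. v \<in> F \<and> v \<in> C" unfolding D_def by blast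
    then obtain g where g: "\<forall>C\<in>D. g C \<in> F \<and> g C \<in> C" by (rule bchoice[THEN exE])
    have "finite (g ` D)" using fin_congsD(2)[OF t] unfolding D_def by simp
    moreover have "g ` D \<subseteq> F" using g by blast
    ultimately obtain s where s: "s \<in> F" "\<And>v. v \<in> g ` D \<Longrightarrow> sublist v s"
      using recurrent_contains_finite[OF F] by metis
    have "\<exists>p q r. s = p @ q @ r \<and> (q, v) \<in> \<theta>" if "v \<in> F" for v
    proof -
      have vA: "v \<in> lists A" using that FA by (rule rev_subsetD)
      then have "\<theta> `` {v} \<in> lists A // \<theta>" by (rule quotientI)
      moreover have "v \<in> F \<inter> \<theta> `` {v}" using congs_refl[OF c vA] \<open>v \<in> F\<close> by simp
      ultimately have C: "\<theta> `` {v} \<in> D" unfolding D_def by blast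
      then have "g (\<theta> `` {v}) \<in> \<theta> `` {v}" using g by blast
      then have "(g (\<theta> `` {v}), v) \<in> \<theta>" using congs_sym[OF c] by simp
      moreover have "sublist (g (\<theta> `` {v})) s" using s(2) C by blast
      ultimately show ?thesis unfolding sublist_def by blast
    qed
    with s(1) show "\<exists>s. s \<in> F \<and> (\<forall>v\<in>F. \<exists>p q r. s = p @ q @ r \<and> (q, v) \<in> \<theta>)" by blast
  qed
  then obtain s where s: "\<forall>\<theta>\<in>fin_congs A. s \<theta> \<in> F \<and> (\<forall>v\<in>F. \<exists>p q r. s \<theta> = p @ q @ r \<and> (q, v) \<in> \<theta>)"
    by (rule bchoice[THEN exE])
  have "ulim s \<in> profinite_closure A F" using ulim_in_closure[OF FA] s by blast
  moreover have "J_le M (ulim s) y" if y: "y \<in> profinite_closure A F" for y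
  proof -
    have yc: "y \<in> carrier M" using profinite_closure_carrier[OF FA y] .
    \<comment> \<open>The three pieces are packed into one value so that a single choice selects
      them together. The middle piece is taken in \<open>y \<theta>\<close>, which makes its limit
      equal to \<open>y\<close>.\<close>
    have "\<forall>\<theta>\<in>fin_congs A. \<exists>t. s \<theta> = fst t @ fst (snd t) @ snd (snd t) \<and> fst (snd t) \<in> y \<theta>"
    proof
      fix \<theta> assume t: "\<theta> \<in> fin_congs A"
      obtain v where v: "v \<in> F" "y \<theta> = \<theta> `` {v}"
        using y t unfolding in_profinite_closure_iff[OF FA] by blast
      then obtain p q r where pqr: "s \<theta> = p @ q @ r" "(q, v) \<in> \<theta>"
        using s[rule_format, OF t] by metis
      have "q \<in> y \<theta>" using congs_sym[OF fin_congsD(1)[OF t] pqr(2)] v(2) by simp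
      with pqr(1) show "\<exists>t. s \<theta> = fst t @ fst (snd t) @ snd (snd t) \<and> fst (snd t) \<in> y \<theta>"
        by (intro exI[of _ "(p, q, r)"]) simp
    qed
    then obtain t where t: "\<forall>\<theta>\<in>fin_congs A. s \<theta> = fst (t \<theta>) @ fst (snd (t \<theta>)) @ snd (snd (t \<theta>)) \<and>
        fst (snd (t \<theta>)) \<in> y \<theta>"
      by (rule bchoice[THEN exE])
    define p where "p = (\<lambda>\<theta>. fst (t \<theta>))"
    define q where "q = (\<lambda>\<theta>. fst (snd (t \<theta>)))"
    define r where "r = (\<lambda>\<theta>. snd (snd (t \<theta>)))"
    have t': "s \<theta> = p \<theta> @ q \<theta> @ r \<theta>" "q \<theta> \<in> y \<theta>" if "\<theta> \<in> fin_congs A" for \<theta>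
      using t that unfolding p_def q_def r_def by blast+
    have sl: "s \<theta> \<in> lists A" if "\<theta> \<in> fin_congs A" for \<theta> using s that FA by blast
    then have l: "p \<theta> \<in> lists A" "q \<theta> \<in> lists A" "r \<theta> \<in> lists A" "q \<theta> @ r \<theta> \<in> lists A"
      if "\<theta> \<in> fin_congs A" for \<theta> using t'(1)[OF that] that by (metis append_in_lists_conv)+
    have "ulim s = ulim (\<lambda>\<theta>. p \<theta> @ q \<theta> @ r \<theta>)"
    proof (rule ulim_cong)
      fix \<theta> assume h: "\<theta> \<in> fin_congs A"
      show "(s \<theta>, p \<theta> @ q \<theta> @ r \<theta>) \<in> \<theta>"
        using congs_refl[OF fin_congsD(1)[OF h] sl[OF h]] t'(1)[OF h] by metis
    qed
    also have "\<dots> = ulim p \<otimes>\<^bsub>M\<^esub> ulim (\<lambda>\<theta>. q \<theta> @ r \<theta>)" by (rule ulim_append) (use l in blast)+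
    also have "ulim (\<lambda>\<theta>. q \<theta> @ r \<theta>) = ulim q \<otimes>\<^bsub>M\<^esub> ulim r" by (rule ulim_append) (use l in blast)+
    also have "ulim q = y" by (rule ulim_eq_of_approx[OF yc t'(2)])
    finally have "ulim s = ulim p \<otimes>\<^bsub>M\<^esub> y \<otimes>\<^bsub>M\<^esub> ulim r"
      using yc ulim_carrier[of p] ulim_carrier[of r] l by (simp add: m_assoc)
    then show ?thesis unfolding J_le_def using ulim_carrier[of p] ulim_carrier[of r] l by blast
  qed
  ultimately show thesis by (rule that)
qed

text \<open>The element \<open>y\<close> is the limit of the connecting words that recurrence gives
  between two copies of each approximation of \<open>x\<close>.\<close>

lemma closure_recurrent:
  assumes F: "recurrent A F" and x: "x \<in> profinite_closure A F"
  obtains y where "y \<in> carrier M" "x \<otimes>\<^bsub>M\<^esub> (y \<otimes>\<^bsub>M\<^esub> x) \<in> profinite_closure A F"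
proof -
  have FA: "F \<subseteq> lists A" using F by (auto simp: recurrent_def subshift_language_def)
  have xc: "x \<in> carrier M" using profinite_closure_carrier[OF FA x] .
  have "\<forall>\<theta>\<in>fin_congs A. \<exists>s. s \<in> F \<and> x \<theta> = \<theta> `` {s}"
    using x unfolding in_profinite_closure_iff[OF FA] by blast
  then obtain s where s: "\<forall>\<theta>\<in>fin_congs A. s \<theta> \<in> F \<and> x \<theta> = \<theta> `` {s \<theta>}" by (rule bchoice[THEN exE])
  then have "\<forall>\<theta>\<in>fin_congs A. \<exists>t. s \<theta> @ t @ s \<theta> \<in> F" using F unfolding recurrent_def by blast
  then obtain t where t: "\<forall>\<theta>\<in>fin_congs A. s \<theta> @ t \<theta> @ s \<theta> \<in> F" by (rule bchoice[THEN exE])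
  then have l: "s \<theta> \<in> lists A" "t \<theta> \<in> lists A" "t \<theta> @ s \<theta> \<in> lists A" if "\<theta> \<in> fin_congs A" for \<theta>
    using that FA by (metis append_in_lists_conv subsetD)+
  have "s \<theta> \<in> x \<theta>" if "\<theta> \<in> fin_congs A" for \<theta>
    using s that congs_refl[OF fin_congsD(1)[OF that] l(1)[OF that]] by blast
  then have sx: "ulim s = x" by (rule ulim_eq_of_approx[OF xc])
  have "ulim (\<lambda>\<theta>. s \<theta> @ t \<theta> @ s \<theta>) = ulim s \<otimes>\<^bsub>M\<^esub> ulim (\<lambda>\<theta>. t \<theta> @ s \<theta>)" by (rule ulim_append) (use l in blast)+
  also have "ulim (\<lambda>\<theta>. t \<theta> @ s \<theta>) = ulim t \<otimes>\<^bsub>M\<^esub> ulim s" by (rule ulim_append) (use l in blast)+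
  finally have "x \<otimes>\<^bsub>M\<^esub> (ulim t \<otimes>\<^bsub>M\<^esub> x) \<in> profinite_closure A F"
    using ulim_in_closure[OF FA, of "\<lambda>\<theta>. s \<theta> @ t \<theta> @ s \<theta>"] t unfolding sx by simp
  then show thesis using that[OF ulim_carrier[of t, OF l(2)]] by blast
qed

end

text \<open>A J-least \<open>x\<close> lies below a product of \<open>x\<close>, \<open>y\<close>
  and \<open>x\<close> in the closure, which gives a factorization of \<open>x\<close> through
  itself whose right cofactor contains \<open>x\<close>. The resulting idempotent fixes
  \<open>x\<close>, hence lies in the closure, and has \<open>x\<close> as a factor, hence is
  J-least too.\<close>

lemma closure_minimal_idempotent:
  assumes F: "recurrent A F"
  obtains d where "d \<in> profinite_closure A F" "d \<otimes>\<^bsub>profinite_monoid A\<^esub> d = d"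
    "\<And>y. y \<in> profinite_closure A F \<Longrightarrow> J_le (profinite_monoid A) d y"
proof -
  obtain U where "profinite_ultrafilter A U" by (rule profinite_ultrafilter_exists)
  then interpret profinite_ultrafilter A U .
  have FA: "F \<subseteq> lists A" and fac: "factorial F"
    using F by (auto simp: recurrent_def subshift_language_def)
  obtain x where x: "x \<in> profinite_closure A F" "\<And>y. y \<in> profinite_closure A F \<Longrightarrow> J_le M x y"
    using closure_has_J_below[OF F] by metis
  have xc: "x \<in> carrier M" using profinite_closure_carrier[OF FA x(1)] .
  obtain y where y: "y \<in> carrier M" "x \<otimes>\<^bsub>M\<^esub> (y \<otimes>\<^bsub>M\<^esub> x) \<in> profinite_closure A F"
    using closure_recurrent[OF F x(1)] .
  obtain a b where ab: "a \<in> carrier M" "b \<in> carrier M" "x = a \<otimes>\<^bsub>M\<^esub> (x \<otimes>\<^bsub>M\<^esub> (y \<otimes>\<^bsub>M\<^esub> x)) \<otimes>\<^bsub>M\<^esub> b"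
    using x(2)[OF y(2)] unfolding J_le_def by blast
  have "x = a \<otimes>\<^bsub>M\<^esub> x \<otimes>\<^bsub>M\<^esub> (y \<otimes>\<^bsub>M\<^esub> x \<otimes>\<^bsub>M\<^esub> b)"
    using ab xc y(1) by (simp add: m_assoc)
  then obtain f c where f: "f \<in> carrier M" "c \<in> carrier M" "f \<otimes>\<^bsub>M\<^esub> f = f" "x \<otimes>\<^bsub>M\<^esub> f = x"
    "f = (y \<otimes>\<^bsub>M\<^esub> x \<otimes>\<^bsub>M\<^esub> b) \<otimes>\<^bsub>M\<^esub> c"
    using idempotent_of_fixed_factorization[OF xc ab(1), of "y \<otimes>\<^bsub>M\<^esub> x \<otimes>\<^bsub>M\<^esub> b"] xc y(1) ab(2) m_closed by metis
  have "f \<in> profinite_closure A F"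
    using profinite_closure_factorial[OF FA fac xc f(1) one_closed] f(4) x(1) xc by simp
  moreover have "f = y \<otimes>\<^bsub>M\<^esub> x \<otimes>\<^bsub>M\<^esub> (b \<otimes>\<^bsub>M\<^esub> c)" using f(2,5) xc y(1) ab(2) by (simp add: m_assoc)
  then have "J_le M f x" unfolding J_le_def using y(1) ab(2) f(2) by blast
  then have "J_le M f z" if "z \<in> profinite_closure A F" for z
    using J_le_trans x(2)[OF that] profinite_closure_carrier[OF FA that] by blast
  ultimately show thesis using that f(3) by blast
qed


section \<open>Decoding by a charged code\<close>

text \<open>The first and last \<open>n\<close> letters form a finite invariant because
  \<open>A\<close> is finite. Taking \<open>n\<close> as the sum of both lengths keeps the prefix
  \<open>u\<close> and the suffix \<open>v\<close> from overlapping in \<open>s\<close>.\<close>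

lemma ends_fin_congs:
  fixes A :: "'a set" and u v :: "'a list"
  assumes "finite A"
  obtains \<theta> where "\<theta> \<in> fin_congs A"
    "\<And>w s. (u @ w @ v, s) \<in> \<theta> \<Longrightarrow> \<exists>w'. s = u @ w' @ v"
proof -
  define n where "n = length u + length v"
  let ?g = "\<lambda>s :: 'a list. (take n s, take n (rev s))"
  let ?E = "{(s, t). s \<in> lists A \<and> t \<in> lists A \<and> ?g s = ?g t}"
  have "?E \<in> fin_congs A"
  proof (rule kernel_fin_congs)
    let ?B = "{xs. set xs \<subseteq> A \<and> length xs \<le> n}"
    have "take n s \<in> ?B" "take n (rev s) \<in> ?B" if "s \<in> lists A" for s
      using that set_take_subset[of n s] set_take_subset[of n "rev s"] by auto
    then have "?g ` lists A \<subseteq> ?B \<times> ?B" by blast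
    then show "finite (?g ` lists A)"
      by (rule finite_subset) (use finite_lists_length_le[OF assms] in simp)
    \<comment> \<open>Truncation of a product depends only on truncations of its factors; the
      reversed words give the same for suffixes.\<close>
    have app: "take n (s @ t) = take n (take n s @ take n t)" for s t :: "'a list"
      by (simp add: min_def)
    show "?g (s @ t) = ?g (s' @ t')" if "?g s = ?g s'" "?g t = ?g t'" for s s' t t'
      using that app[of s t] app[of s' t'] app[of "rev t" "rev s"] app[of "rev t'" "rev s'"]
      by (simp del: take_append)
  qed
  moreover have "\<exists>w'. s = u @ w' @ v" if "(u @ w @ v, s) \<in> ?E" for w s
  proof -
    have e: "take n s = take n (u @ w @ v)" "take n (rev s) = take n (rev (u @ w @ v))"
      using that by auto
    have "length (take n s) = n" unfolding e(1) by (simp add: n_def)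
    then have len: "length s \<ge> n" by simp
    have "take (length u) s = take (length u) (take n s)" by (simp add: n_def min_def)
    also have "\<dots> = u" unfolding e(1) by (simp add: n_def)
    finally obtain t where t: "s = u @ t" by (metis append_take_drop_id)
    have "take (length v) (rev s) = take (length v) (take n (rev s))" by (simp add: n_def min_def)
    also have "\<dots> = rev v" unfolding e(2) by (simp add: n_def)
    finally have "take (length v) (rev t) = rev v" using len unfolding t by (simp add: n_def)
    then obtain z where "rev t = rev v @ z" by (metis append_take_drop_id)
    then have "t = rev z @ v" by (metis rev_append rev_rev_ident)
    then show ?thesis unfolding t by blast
  qed
  ultimately show thesis by (rule that)
qed

text \<open>The first factors of two factorizations over \<open>Z\<close> are comparable as
  prefixes, hence equal, and can be removed one after the other.\<close>

lemma bifix_star_cancel_left: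
  assumes "bifix Z" "[] \<notin> Z" "u \<in> star Z" "u @ t \<in> star Z"
  shows "t \<in> star Z"
  using assms(3,4)
proof (induction rule: star_induct)
  case Nil
  then show ?case by simp
next
  case (append x w)
  obtain ys where ys: "ys \<in> lists Z" "x @ w @ t = concat ys"
    using append.prems by (auto simp: star_def)
  have "ys \<noteq> []" using ys(2) append.hyps assms(2) by auto
  then obtain y zs where y: "ys = y # zs" by (cases ys) auto
  have "x @ (w @ t) = y @ concat zs" using ys(2) y by simp
  then have "prefix x y \<or> prefix y x" by (metis prefix_same_cases prefixI)
  moreover have "x \<in> Z" "y \<in> Z" using append.hyps ys y by auto
  ultimately have "x = y" using assms(1) unfolding bifix_def by (metis prefix_order.le_imp_less_or_eq)
  then have "w @ t = concat zs" using ys(2) y by simp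
  moreover have "concat zs \<in> star Z" using ys(1) y by (simp add: star_def)
  ultimately show ?case using append.IH by simp
qed

lemma bifix_star_cancel_right:
  assumes "bifix Z" "[] \<notin> Z" "u \<in> star Z" "t @ u \<in> star Z"
  shows "t \<in> star Z"
proof -
  have "\<forall>t. t @ concat us \<in> star Z \<longrightarrow> t \<in> star Z" if "us \<in> lists Z" for us
    using that
  proof (induction us rule: rev_induct)
    case Nil
    then show ?case by simp
  next
    case (snoc x us)
    show ?case
    proof (intro allI impI)
      fix t assume "t @ concat (us @ [x]) \<in> star Z"
      then obtain ys where ys: "ys \<in> lists Z" "t @ concat us @ x = concat ys"
        by (auto simp: star_def)
      have xZ: "x \<in> Z" "us \<in> lists Z" using snoc.prems by auto
      then have "ys \<noteq> []" using ys(2) assms(2) by auto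
      then obtain y zs where y: "ys = zs @ [y]" by (cases ys rule: rev_cases) auto
      have eq: "(t @ concat us) @ x = concat zs @ y" using ys(2) y by simp
      then have "suffix x y \<or> suffix y x" by (metis suffix_same_cases suffixI)
      moreover have "y \<in> Z" using ys y by auto
      ultimately have "x = y" using assms(1) xZ(1) unfolding bifix_def
        by (metis suffix_order.le_imp_less_or_eq)
      then have "t @ concat us = concat zs" using eq by simp
      moreover have "concat zs \<in> star Z" using ys(1) y by (simp add: star_def)
      ultimately show "t \<in> star Z" using snoc.IH xZ(2) by simp
    qed
  qed
  moreover obtain us where "us \<in> lists Z" "u = concat us" using assms(3) by (auto simp: star_def)
  ultimately show ?thesis using assms(4) by blast
qed

section \<open>Connecting two words through a maximal subgroup\<close>

lemma charged_star_connects: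
  assumes A: "finite A" and F: "recurrent A F" and Z: "F_charged A F Z"
    and u: "u \<in> F" "u \<in> star Z" and v: "v \<in> F" "v \<in> star Z"
  obtains w where "w \<in> star Z" "u @ w @ v \<in> F"
proof -
  let ?M = "profinite_monoid A" and ?S = "synt_cong A (star Z)"
  let ?cl = "profinite_closure A F"
  interpret monoid ?M by (rule profinite_monoid_is_monoid)
  have FA: "F \<subseteq> lists A" and fac: "factorial F"
    using F by (auto simp: recurrent_def subshift_language_def)
  have code: "code_over A Z" "bifix Z" "complete_in (lists A) Z" "rational A Z"
    and charged: "\<And>K. K \<in> maximal_subgroups ?M \<Longrightarrow> K \<subseteq> J_class A F \<Longrightarrow>
        synt_hat A (star Z) ` K \<in> maximal_subgroups (synt_monoid A (star Z)) \<and>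
        synt_hat A (star Z) ` K \<subseteq> minimum_ideal (synt_monoid A (star Z))"
    using Z unfolding F_charged_def by blast+
  have ZA: "Z \<subseteq> lists A" and ZN: "[] \<notin> Z" using code(1) by (auto simp: code_over_def)
  have starA: "star Z \<subseteq> lists A" using star_lists[OF ZA] .
  have S: "?S \<in> fin_congs A" using rational_synt_cong[OF rational.star[OF code(4)]] .
  note c = fin_congsD(1)[OF S]
  note fac_cl = profinite_closure_factorial[OF FA fac]
  note cl_car = profinite_closure_carrier[OF FA]
  have hat: "synt_hat A (star Z) x = x ?S" if "x \<in> carrier ?M" for x
  proof (rule synt_hat_eq(2)[OF _ that])
    show "finite (carrier (synt_monoid A (star Z)))"
      using fin_congsD(2)[OF S] by (simp add: synt_monoid_def quot_monoid_def)
  qed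
  have emb_cl: "emb A w \<in> ?cl" if "w \<in> F" for w
    using that FA emb_in_carrier[of w A] unfolding in_profinite_closure_iff[OF FA] by (auto simp: emb_def)
  obtain d where d: "d \<in> ?cl" "d \<otimes>\<^bsub>?M\<^esub> d = d" "\<And>y. y \<in> ?cl \<Longrightarrow> J_le ?M d y"
    using closure_minimal_idempotent[OF F] by metis
  have dc: "d \<in> carrier ?M" using cl_car[OF d(1)] .
  define U where "U = emb A u"
  define V where "V = emb A v"
  have UV: "U \<in> ?cl" "V \<in> ?cl" "U \<in> carrier ?M" "V \<in> carrier ?M"
    using emb_cl u(1) v(1) cl_car unfolding U_def V_def by blast+
  obtain p q where p: "p \<in> carrier ?M" "q \<in> carrier ?M" "d = p \<otimes>\<^bsub>?M\<^esub> V \<otimes>\<^bsub>?M\<^esub> q"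
    using d(3)[OF UV(2)] unfolding J_le_def by blast
  obtain p' q' where p': "p' \<in> carrier ?M" "q' \<in> carrier ?M" "d = p' \<otimes>\<^bsub>?M\<^esub> U \<otimes>\<^bsub>?M\<^esub> q'"
    using d(3)[OF UV(1)] unfolding J_le_def by blast
  \<comment> \<open>Rotating the two factorizations of \<open>d\<close> moves \<open>V\<close> to
    the right end of \<open>f\<close> and \<open>U\<close> to the left end of
    \<open>e\<close>.\<close>
  define f where "f = q \<otimes>\<^bsub>?M\<^esub> d \<otimes>\<^bsub>?M\<^esub> p \<otimes>\<^bsub>?M\<^esub> V"
  define e where "e = U \<otimes>\<^bsub>?M\<^esub> q' \<otimes>\<^bsub>?M\<^esub> d \<otimes>\<^bsub>?M\<^esub> p'"
  note fprops = idempotent_with_suffix[OF dc p(1) UV(4) p(2) d(2) p(3), folded f_def]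
  note eprops = idempotent_with_prefix[OF dc p'(1) UV(3) p'(2) d(2) p'(3), folded e_def]
  have fc: "f \<in> carrier ?M" and ec: "e \<in> carrier ?M" using dc p p' UV by (simp_all add: f_def e_def)
  have fcl: "f \<in> ?cl"
    using fac_cl[of "p \<otimes>\<^bsub>?M\<^esub> V" f q] d(1) fprops(2) fc p UV(4) by simp
  have "f = q \<otimes>\<^bsub>?M\<^esub> d \<otimes>\<^bsub>?M\<^esub> (p \<otimes>\<^bsub>?M\<^esub> V)" unfolding f_def using p dc UV by (simp add: m_assoc)
  then have fd: "J_le ?M f d" unfolding J_le_def using p UV(4) m_closed by blast
  have f_min: "J_le ?M f y" if "y \<in> ?cl" for y
    using J_le_trans[OF fd d(3)[OF that] cl_car[OF that]] .
  have "J_le ?M d e" unfolding J_le_def using eprops(2) p' UV(3) m_closed by blast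
  then have "J_le ?M f e" using J_le_trans[OF fd _ ec] by blast
  then obtain a b where ab: "a \<in> carrier ?M" "b \<in> carrier ?M" "f = a \<otimes>\<^bsub>?M\<^esub> e \<otimes>\<^bsub>?M\<^esub> b"
    unfolding J_le_def by blast
  (* f = a z0 and z0 f = z0 put z0 in the L-class of f. It remains to move z0 inside its H-class into
     the closure of star Z, by a factor from the maximal subgroup K of f. *)
  define z0 where "z0 = e \<otimes>\<^bsub>?M\<^esub> b \<otimes>\<^bsub>?M\<^esub> f"
  have z0c: "z0 \<in> carrier ?M" using ab ec fc by (simp add: z0_def)
  have z0f: "z0 \<otimes>\<^bsub>?M\<^esub> f = z0" using fprops(1) ab ec fc by (simp add: z0_def m_assoc)
  have "a \<otimes>\<^bsub>?M\<^esub> z0 = (a \<otimes>\<^bsub>?M\<^esub> e \<otimes>\<^bsub>?M\<^esub> b) \<otimes>\<^bsub>?M\<^esub> f" using ab ec fc by (simp add: z0_def m_assoc)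
  then have az0: "f = a \<otimes>\<^bsub>?M\<^esub> z0" using fprops(1) unfolding ab(3)[symmetric] by simp

  define K where "K = H_class ?M f"
  have fK: "f \<in> K" unfolding K_def using H_class_refl[OF fc] .
  have "K \<in> maximal_subgroups ?M"
    unfolding maximal_subgroups_def using fK fprops(1) fc unfolding K_def by blast
  \<comment> \<open>Elements of \<open>K\<close> are factors of \<open>f\<close>, which keeps them
    in the closure, and multiples of \<open>f\<close>, which keeps them J-below all of it.\<close>
  moreover have KJ: "K \<subseteq> J_class A F"
  proof
    fix k assume "k \<in> K"
    then have kc: "k \<in> carrier ?M" and "R_eq ?M f k" unfolding K_def H_class_def by blast+
    then obtain w w' where w: "w \<in> carrier ?M" "f = k \<otimes>\<^bsub>?M\<^esub> w" "w' \<in> carrier ?M" "k = f \<otimes>\<^bsub>?M\<^esub> w'"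
      unfolding R_eq_def R_le_def by blast
    have "k \<in> ?cl" using fac_cl[of "\<one>\<^bsub>?M\<^esub>" k w] w(1,2) fcl kc by simp
    moreover have "k = \<one>\<^bsub>?M\<^esub> \<otimes>\<^bsub>?M\<^esub> f \<otimes>\<^bsub>?M\<^esub> w'" using w(3,4) fc by simp
    then have "J_le ?M k f" unfolding J_le_def using w(3) one_closed by blast
    then have "J_le ?M k y" if "y \<in> ?cl" for y using J_le_trans f_min[OF that] cl_car[OF that] by blast
    ultimately show "k \<in> J_class A F" unfolding J_class_def by blast
  qed
  ultimately have img: "synt_hat A (star Z) ` K \<in> maximal_subgroups (synt_monoid A (star Z))"
    "synt_hat A (star Z) ` K \<subseteq> minimum_ideal (synt_monoid A (star Z))"
    using charged by blast+

  \<comment> \<open>Representatives modulo \<open>?S\<close> transfer the computation to the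
    syntactic monoid.\<close>
  obtain fw where fw: "fw \<in> lists A" "f ?S = ?S `` {fw}" using profinite_class[OF fc S] .
  obtain aw where aw: "aw \<in> lists A" "a ?S = ?S `` {aw}" using profinite_class[OF ab(1) S] .
  obtain z where z: "z \<in> lists A" "z0 ?S = ?S `` {z}" using profinite_class[OF z0c S] .
  have rel: "(x, y) \<in> ?S" if "?S `` {x} = ?S `` {y}" "x \<in> lists A" "y \<in> lists A" for x y
    using that congs_class_eq_iff[OF c] by blast
  have "?S `` {z} = ?S `` {z @ fw}"
    using profinite_mult_class[OF S z(1) fw(1), of z0 f] z(2) fw(2) z0f by simp
  then have zf: "(z, z @ fw) \<in> ?S" using z(1) fw(1) by (intro rel) simp_all
  have "?S `` {fw} = ?S `` {fw @ fw}"
    using profinite_mult_class[OF S fw(1) fw(1), of f f] fw(2) fprops(1) by simp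
  then have ff: "(fw, fw @ fw) \<in> ?S" using fw(1) by (intro rel) simp_all

  \<comment> \<open>Completeness extends \<open>z\<close> into \<open>star Z\<close> by
    \<open>r\<close> on the right and by \<open>l\<close> on the left, so
    \<open>z @ r @ l @ z\<close> is a product of two words of \<open>star Z\<close>.\<close>
  have "(\<exists>y\<in>star Z. prefix z y)" "(\<exists>y\<in>star Z. suffix z y)"
    using code(3) z(1) unfolding complete_in_def by blast+
  then obtain r l where zr: "z @ r \<in> star Z" and lz: "l @ z \<in> star Z"
    unfolding prefix_def suffix_def by blast
  have rl: "r \<in> lists A" "l \<in> lists A" using zr lz starA by (metis append_in_lists_conv subsetD)+
  (* Modulo ?S, the word z k is z r l z, since z absorbs fw on the right. *)
  define k where "k = fw @ r @ l @ z"
  have kA: "k \<in> lists A" using fw z rl by (simp add: k_def)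
  have k1: "(k, fw @ k) \<in> ?S"
    using congs_append[OF c ff congs_refl[OF c, of "r @ l @ z"]] rl z(1) by (simp add: k_def)
  have k2: "(k, k @ fw) \<in> ?S"
    using congs_append[OF c congs_refl[OF c, of "fw @ r @ l"] zf] rl fw(1) by (simp add: k_def)
  have imgf: "?S `` {fw} \<in> synt_hat A (star Z) ` K"
    using fK hat[OF fc] fw(2) by (metis imageI)
  have "?S `` {k} \<in> H_class (quot_monoid A ?S) (?S `` {fw})"
    using img(2) imgf by (intro minimum_ideal_H_class[OF S fw(1) _ k1 k2]) (auto simp: synt_monoid_def)
  \<comment> \<open>Charging makes the image of \<open>K\<close> an entire H-class, so the class of
    \<open>k\<close> has a preimage in \<open>K\<close>.\<close>
  then have "?S `` {k} \<in> synt_hat A (star Z) ` K"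
    using monoid.maximal_subgroup_H_class[OF quot_monoid_is_monoid[OF c]] img(1) imgf
    unfolding synt_monoid_def by blast
  then obtain \<kappa> where \<kappa>: "\<kappa> \<in> K" "synt_hat A (star Z) \<kappa> = ?S `` {k}" by force
  have \<kappa>c: "\<kappa> \<in> carrier ?M" and "R_eq ?M f \<kappa>" "L_eq ?M f \<kappa>"
    using \<kappa>(1) unfolding K_def H_class_def by blast+
  \<comment> \<open>\<open>g\<close> leads from \<open>\<kappa>\<close> back to \<open>f\<close>,
    \<open>h\<close> shows that \<open>\<kappa>\<close> ends in \<open>f\<close> and thus in
    \<open>V\<close>, and \<open>h'\<close> makes \<open>f\<close> a left identity for
    \<open>\<kappa>\<close>.\<close>
  then obtain g h h' where g: "g \<in> carrier ?M" "f = \<kappa> \<otimes>\<^bsub>?M\<^esub> g" and h: "h \<in> carrier ?M" "\<kappa> = h \<otimes>\<^bsub>?M\<^esub> f"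
    and h': "h' \<in> carrier ?M" "\<kappa> = f \<otimes>\<^bsub>?M\<^esub> h'"
    unfolding R_eq_def L_eq_def R_le_def L_le_def by metis
  have \<kappa>S: "\<kappa> ?S = ?S `` {k}" using hat[OF \<kappa>c] \<kappa>(2) by simp
  have f\<kappa>: "f \<otimes>\<^bsub>?M\<^esub> \<kappa> = \<kappa>" using h' fprops(1) fc by (metis m_assoc)
  define z1 where "z1 = z0 \<otimes>\<^bsub>?M\<^esub> \<kappa>"
  have z1c: "z1 \<in> carrier ?M" using z0c \<kappa>c by (simp add: z1_def)
  \<comment> \<open>Multiplying by \<open>a\<close> and \<open>g\<close> turns \<open>z1\<close>
    back into \<open>f\<close>, so \<open>z1\<close> is a factor of an element of the
    closure.\<close>
  have "a \<otimes>\<^bsub>?M\<^esub> z1 \<otimes>\<^bsub>?M\<^esub> g = (a \<otimes>\<^bsub>?M\<^esub> z0) \<otimes>\<^bsub>?M\<^esub> \<kappa> \<otimes>\<^bsub>?M\<^esub> g"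
    using ab z0c \<kappa>c g(1) by (simp add: z1_def m_assoc)
  also have "\<dots> = f" unfolding az0[symmetric] f\<kappa> using g(2) by simp
  finally have z1cl: "z1 \<in> ?cl" using fac_cl[OF ab(1) z1c g(1)] fcl by simp
  have z1S: "z1 ?S = ?S `` {z @ k}"
    unfolding z1_def using S z kA \<kappa>S by (intro profinite_mult_class)
  \<comment> \<open>\<open>y\<close> collects everything between the initial \<open>U\<close> of
    \<open>e\<close> and the final \<open>V\<close> of the copy of \<open>f\<close> supplied by
    \<open>h\<close>.\<close>
  define y where "y = q' \<otimes>\<^bsub>?M\<^esub> d \<otimes>\<^bsub>?M\<^esub> p' \<otimes>\<^bsub>?M\<^esub> b \<otimes>\<^bsub>?M\<^esub> f \<otimes>\<^bsub>?M\<^esub> h \<otimes>\<^bsub>?M\<^esub> q \<otimes>\<^bsub>?M\<^esub> d \<otimes>\<^bsub>?M\<^esub> p"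
  have yc: "y \<in> carrier ?M" using p p' dc ab fc h by (simp add: y_def)
  have "z1 = e \<otimes>\<^bsub>?M\<^esub> b \<otimes>\<^bsub>?M\<^esub> f \<otimes>\<^bsub>?M\<^esub> (h \<otimes>\<^bsub>?M\<^esub> f)" unfolding z1_def z0_def h(2)[symmetric] ..
  also have "\<dots> = U \<otimes>\<^bsub>?M\<^esub> q' \<otimes>\<^bsub>?M\<^esub> d \<otimes>\<^bsub>?M\<^esub> p' \<otimes>\<^bsub>?M\<^esub> b \<otimes>\<^bsub>?M\<^esub> f \<otimes>\<^bsub>?M\<^esub> (h \<otimes>\<^bsub>?M\<^esub> (q \<otimes>\<^bsub>?M\<^esub> d \<otimes>\<^bsub>?M\<^esub> p \<otimes>\<^bsub>?M\<^esub> V))"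
    by (simp only: e_def) (simp only: f_def)
  also have "\<dots> = U \<otimes>\<^bsub>?M\<^esub> y \<otimes>\<^bsub>?M\<^esub> V" using p p' dc ab fc h UV by (simp add: y_def m_assoc)
  finally have z1UV: "z1 = U \<otimes>\<^bsub>?M\<^esub> y \<otimes>\<^bsub>?M\<^esub> V" .

  have uA: "u \<in> lists A" and vA: "v \<in> lists A" using u v FA by blast+
  obtain \<epsilon> where \<epsilon>: "\<epsilon> \<in> fin_congs A" "\<And>w s. (u @ w @ v, s) \<in> \<epsilon> \<Longrightarrow> \<exists>w'. s = u @ w' @ v"
    using ends_fin_congs[OF A] by metis
  \<comment> \<open>A single approximation modulo the intersection shows on one word
    \<open>s\<close> both membership in \<open>star Z\<close> and the ends \<open>u\<close> and
    \<open>v\<close>.\<close>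
  have T: "?S \<inter> \<epsilon> \<in> fin_congs A" (is "?T \<in> _") using fin_congs_Int[OF S \<epsilon>(1)] .
  obtain s where s: "s \<in> F" "z1 ?T = ?T `` {s}"
    using z1cl T unfolding in_profinite_closure_iff[OF FA] by blast
  have sA: "s \<in> lists A" using s(1) FA by (rule rev_subsetD)
  obtain yw where yw: "yw \<in> lists A" "y ?T = ?T `` {yw}" using profinite_class[OF yc T] .
  have "U ?T = ?T `` {u}" "V ?T = ?T `` {v}" using T by (simp_all add: U_def V_def emb_def)
  then have "z1 ?T = ?T `` {(u @ yw) @ v}"
    unfolding z1UV using T uA vA yw by (intro profinite_mult_class) simp_all
  then have "(u @ yw @ v, s) \<in> ?T"
    using s(2) congs_class_eq_iff[OF fin_congsD(1)[OF T], of "u @ yw @ v" s] uA vA yw(1) sA by simp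
  then obtain w where w: "s = u @ w @ v" using \<epsilon>(2) by blast
  have "z1 ?S = ?S `` {s}" by (rule profinite_eq_if_subset[OF z1c T S _ s(2) sA]) simp
  then have "(z @ k, s) \<in> ?S" using z1S z(1) kA sA by (intro rel) simp_all
  moreover have "(z @ r @ l @ z, z @ k) \<in> ?S"
    using congs_append[OF c zf congs_refl[OF c, of "r @ l @ z"]] rl z(1) by (simp add: k_def)
  ultimately have "(z @ r @ l @ z, s) \<in> ?S" using congs_trans[OF c] by blast
  moreover have "z @ r @ l @ z \<in> star Z" using star_append[OF zr lz] by simp
  ultimately have "s \<in> star Z" using synt_congD[of _ s A "star Z" "[]" "[]"] by auto
  then have "w @ v \<in> star Z" using bifix_star_cancel_left[OF code(2) ZN u(2), of "w @ v"] w by simp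
  then have "w \<in> star Z" by (rule bifix_star_cancel_right[OF code(2) ZN v(2)])
  then show thesis using that s(1) w by blast
qed

section \<open>Passage to the alphabet \<open>X\<close>\<close>

lemma sublist_concat: "sublist vs us \<Longrightarrow> sublist (concat vs) (concat us)"
  unfolding sublist_def by (metis concat_append)

lemma factorial_decoding: "factorial F \<Longrightarrow> factorial (decoding X F)"
  unfolding factorial_def decoding_def
  using sublist_concat set_mono_sublist by (fastforce simp: lists_eq_set)

text \<open>Prolongability comes from the connection property: linking a word with a one-letter word
  on either side gives a nonempty extension, and factoriality keeps its adjacent letter.\<close>

lemma recurrentI_connected:
  assumes "X \<noteq> {}" "D \<subseteq> lists X" "factorial D" "\<And>x. x \<in> X \<Longrightarrow> [x] \<in> D"
    and conn: "\<And>us vs. us \<in> D \<Longrightarrow> vs \<in> D \<Longrightarrow> \<exists>ws\<in>D. us @ ws @ vs \<in> D"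
  shows "recurrent X D"
proof -
  obtain x where x: "x \<in> X" "[x] \<in> D" using assms(1,4) by blast
  have "\<exists>a\<in>X. \<exists>b\<in>X. a # us \<in> D \<and> us @ [b] \<in> D" if us: "us \<in> D" for us
  proof -
    obtain ws where ws: "us @ ws @ [x] \<in> D" using conn[OF us x(2)] by blast
    \<comment> \<open>If \<open>ws\<close> is empty, then \<open>b\<close> is \<open>x\<close>
      itself.\<close>
    obtain b ts where b: "ws @ [x] = b # ts" by (cases ws) auto
    have "us @ ws @ [x] = [] @ (us @ [b]) @ ts" using b by simp
    then have usb: "us @ [b] \<in> D" using ws assms(3) unfolding factorial_def sublist_def by blast
    obtain ws' where ws': "[x] @ ws' @ us \<in> D" using conn[OF x(2) us] by blast
    obtain a ts' where a: "[x] @ ws' = ts' @ [a]" by (cases "[x] @ ws'" rule: rev_cases) auto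
    have "[x] @ ws' @ us = ([x] @ ws') @ us" by simp
    also have "\<dots> = ts' @ (a # us) @ []" unfolding a by simp
    finally have "a # us \<in> D" using ws' assms(3) unfolding factorial_def sublist_def by metis
    with usb show ?thesis using assms(2) by (metis Cons_in_lists_iff append_in_lists_conv subsetD)
  qed
  then have "subshift_language X D"
    unfolding subshift_language_def prolongable_def using assms(2,3) x(2) by blast
  then show ?thesis unfolding recurrent_def using assms(2) conn by blast
qed

theorem theorem4p6:
  fixes A :: "'a set" and F X :: "'a list set"
  assumes "alphabet A"
    and "recurrent A F"
    and "finite X"
    and "X \<subseteq> F"
    and "F_complete_F_charged A F X"
  shows "recurrent X (decoding X F)"
proof (rule recurrentI_connected)
  obtain Z where Z: "F_charged A F Z" "X = Z \<inter> F" and code: "code_over A X"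
    using assms(5) unfolding F_complete_F_charged_def F_complete_def by blast
  have fac: "factorial F" using assms(2) by (simp add: recurrent_def subshift_language_def)
  show "X \<noteq> {}" using code by (simp add: code_over_def)
  show "decoding X F \<subseteq> lists X" by (auto simp: decoding_def)
  show "factorial (decoding X F)" using fac by (rule factorial_decoding)
  show "[x] \<in> decoding X F" if "x \<in> X" for x using that assms(4) by (auto simp: decoding_def)
  fix us vs assume "us \<in> decoding X F" "vs \<in> decoding X F"
  then have l: "us \<in> lists X" "vs \<in> lists X" and F: "concat us \<in> F" "concat vs \<in> F"
    unfolding decoding_def by blast+
  then have "concat us \<in> star Z" "concat vs \<in> star Z"
    using Z(2) star_mono[of X Z] by (auto simp: star_def)
  then obtain w where w: "w \<in> star Z" "concat us @ w @ concat vs \<in> F"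
    using charged_star_connects[OF _ assms(2) Z(1) F(1) _ F(2)] assms(1) unfolding alphabet_def by metis
  obtain ws where ws: "ws \<in> lists Z" "w = concat ws" using w(1) by (auto simp: star_def)
  have wF: "w \<in> F" using w(2) fac unfolding factorial_def sublist_def by blast
  \<comment> \<open>So far the factors of \<open>w\<close> are only known to lie in
    \<open>Z\<close>. As factors of a word of \<open>F\<close> they lie in
    \<open>Z \<inter> F\<close>, which is \<open>X\<close>.\<close>
  have "x \<in> F" if x: "x \<in> set ws" for x
  proof -
    obtain ps qs where "ws = ps @ x # qs" using split_list[OF x] by blast
    then have "w = concat ps @ x @ concat qs" using ws(2) by simp
    then show ?thesis using wF fac unfolding factorial_def sublist_def by blast
  qed
  then have "ws \<in> lists X" using ws(1) Z(2) by auto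
  then have "ws \<in> decoding X F" "us @ ws @ vs \<in> decoding X F"
    using l w(2) wF ws(2) by (simp_all add: decoding_def)
  then show "\<exists>ws\<in>decoding X F. us @ ws @ vs \<in> decoding X F" by blast
qed

end
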